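(* Let $q=3^k$ with $k\geq 2$, and let $\theta$ be any system of representatives of the circles $C_d$, $d\in\mathbb{F}_q^*$. Then the line system $\mathcal{L}_{\pi_2}$ is $(q-1)$-dimensional (it is a system of lines in the $(q-1)$-dimensional complex Hilbert space $H(\mathbb{F}_q^* )$) and $|\mathcal{L}_{\pi_2}|=q^2-1$. Additionally, its angle set is $\{0,\sqrt{3/q}\}$, and half of the lines, denoted by $\mathcal{L}_{\pi_2}^+$, lie entirely in the subspace $H(QR_q)$, while the other half, denoted by $\mathcal{L}_{\pi_2}^-$, lie in the subspace $H(NQR_q)$.
   Context: Let $\mathbb{F}_q$ be the field with $q=p^n$ elements, $p$ an odd prime, and $\mathbb{L}/\mathbb{F}_q$ its quadratic extension. For $z\in\mathbb{L}$ put $N(z)=z^{q+1}$ and $S(z)=z+z^q$ (relative norm and trace to $\mathbb{F}_q$). For $d\in\mathbb{F}_q^*$ the circle $C_d$ is $\{t\in\mathbb{L}: N(t)=d\}$; $C=C_1$ is a cyclic subgroup of $\mathbb{L}^*$ of order $q+1$. Since $q$ is odd, $C$ has a unique character $\pi_2:C\to\{\pm1\}$ of order $2$. Let $\chi(x)=e^{2\pi i\,\mathrm{Tr}(x)/p}$ for $x\in\mathbb{F}_q$, where $\mathrm{Tr}:\mathbb{F}_q\to\mathbb{F}_p$ is the absolute trace. $QR_q$ and $NQR_q$ denote the sets of nonzero squares and of nonsquares in $\mathbb{F}_q^*$. The Bessel function of $\mathbb{L}$ attached to $\pi_2$ is $J_{\pi_2}(z)=\frac1q\sum_{t\in C}\chi(-S(tz))\pi_2(t)$,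 $z\in\mathbb{L}$. It satisfies $J_{\pi_2}(tz)=\overline{\pi_2}(t)J_{\pi_2}(z)$ for $t\in C$. $H(\mathbb{F}_q^* )$ is the Hilbert space of complex functions on $\mathbb{F}_q^*$ with the standard inner product; $H(QR_q)$ and $H(NQR_q)$ are its subspaces of functions supported on $QR_q$ and on $NQR_q$ respectively. For $y\in\mathbb{F}_q^*$, $\delta_y$ is the function equal to $1$ at $y$ and $0$ elsewhere. A system of representatives $\theta=\{x_d\mid d\in\mathbb{F}_q^*\}$ consists of one element $x_d\in C_d$ for each $d\in\mathbb{F}_q^*$. For such $\theta$ let $\Phi_{\pi_2,\theta}\subset H(\mathbb{F}_q^* )$ be the set consisting of the vectors $$v\mapsto \chi(av)\,J_{\pi_2}(x_y x_v),\qquad a\in\mathbb{F}_q,\ y\in\mathbb{F}_q^*,$$ together with the vectors $\delta_y$, $y\in\mathbb{F}_q^*$. These are unit vectors. The line system $\mathcal{L}_{\pi_2}$ is the set of lines spanned by the vectors of $\Phi_{\pi_2,\theta}$ (up to isometry, and as regards the properties considered here, it does not depend on $\theta$). The angle set of a set of lines, each represented by one unit vector, is the set of values $|\langle x,y\rangle|$ over representatives $x,y$ of distinct lines. *)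

theory Defs
  imports "HOL-Analysis.Analysis"
begin

text \<open>
  The type \<open>'f\<close> plays the role of $\mathbb{F}_q$ and the type \<open>'l\<close> that of its quadratic
  extension $\mathbb{L}$; the inclusion is a ring homomorphism \<open>emb\<close>.  Relative norms and
  traces are elements of \<open>'f\<close>: \<open>inv emb\<close> is only applied to elements in the range of \<open>emb\<close>.
\<close>

definition quadratic_extension :: "('f::field \<Rightarrow> 'l::field) \<Rightarrow> bool" where
  "quadratic_extension emb \<longleftrightarrow>
     emb 1 = 1 \<and>
     (\<forall>x y. emb (x + y) = emb x + emb y) \<and>
     (\<forall>x y. emb (x * y) = emb x * emb y) \<and>
     vector_space.dim (\<lambda>a z. emb a * z) (UNIV :: 'l set) = 2"

definition rel_norm :: "('f::{finite,field} \<Rightarrow> 'l::field) \<Rightarrow> 'l \<Rightarrow> 'f" where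
  "rel_norm emb z = inv emb (z ^ (CARD('f) + 1))"

definition rel_trace :: "('f::{finite,field} \<Rightarrow> 'l::field) \<Rightarrow> 'l \<Rightarrow> 'f" where
  "rel_trace emb z = inv emb (z + z ^ CARD('f))"

definition circle :: "('f::{finite,field} \<Rightarrow> 'l::field) \<Rightarrow> 'f \<Rightarrow> 'l set" where
  "circle emb d = {t. rel_norm emb t = d}"

definition representatives :: "('f::{finite,field} \<Rightarrow> 'l::field) \<Rightarrow> ('f \<Rightarrow> 'l) \<Rightarrow> bool" where
  "representatives emb \<theta> \<longleftrightarrow> (\<forall>d. d \<noteq> 0 \<longrightarrow> \<theta> d \<in> circle emb d)"

text \<open>Only the values of \<open>\<pi>\<close> on the group \<open>C\<close> are relevant below.\<close>

definition order_two_character :: "'l::field set \<Rightarrow> ('l \<Rightarrow> complex) \<Rightarrow> bool" where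
  "order_two_character C \<pi> \<longleftrightarrow>
     (\<forall>s\<in>C. \<forall>t\<in>C. \<pi> (s * t) = \<pi> s * \<pi> t) \<and>
     (\<forall>t\<in>C. \<pi> t = 1 \<or> \<pi> t = -1) \<and>
     (\<exists>t\<in>C. \<pi> t \<noteq> 1)"

text \<open>
  For $q = p^n$ with $p$ = \<open>CHAR('f)\<close>, the absolute trace is $\sum_{i<n} x^{p^i}$.  It lies in
  the prime field, whose elements are identified with the residues $0, \dots, p-1$ in order
  to evaluate the additive character.
\<close>

definition abs_degree :: "'f::{finite,field} itself \<Rightarrow> nat" where
  "abs_degree _ = (THE n. CARD('f) = CHAR('f) ^ n)"

definition abs_trace :: "'f::{finite,field} \<Rightarrow> 'f" where
  "abs_trace x = (\<Sum>i<abs_degree TYPE('f). x ^ (CHAR('f) ^ i))"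

definition prime_residue :: "'f::{finite,field} \<Rightarrow> nat" where
  "prime_residue x = (THE m. m < CHAR('f) \<and> of_nat m = x)"

definition add_char :: "'f::{finite,field} \<Rightarrow> complex" where
  "add_char x =
     exp (2 * complex_of_real pi * \<i> * of_nat (prime_residue (abs_trace x)) / of_nat CHAR('f))"

definition bessel :: "('f::{finite,field} \<Rightarrow> 'l::field) \<Rightarrow> ('l \<Rightarrow> complex) \<Rightarrow> 'l \<Rightarrow> complex" where
  "bessel emb \<pi> z =
     1 / of_nat CARD('f) * (\<Sum>t\<in>circle emb 1. add_char (- rel_trace emb (t * z)) * \<pi> t)"

definition nonzero_elems :: "'f::field set" where
  "nonzero_elems = {x. x \<noteq> 0}"

definition QR :: "'f::field set" where
  "QR = {x. x \<noteq> 0 \<and> (\<exists>y. x = y\<^sup>2)}"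

definition NQR :: "'f::field set" where
  "NQR = {x. x \<noteq> 0 \<and> \<not> (\<exists>y. x = y\<^sup>2)}"

text \<open>
  A complex function on a subset \<open>A\<close> of \<open>'f\<close> is encoded as a vector indexed by all of \<open>'f\<close>
  that vanishes outside \<open>A\<close>.  In particular $H(\mathbb{F}_q^*)$ is \<open>H_space nonzero_elems\<close>.
\<close>

definition H_space :: "'f::{finite,field} set \<Rightarrow> (complex ^ 'f::{finite,field}) set" where
  "H_space A = {f. \<forall>x. x \<notin> A \<longrightarrow> f $ x = 0}"

definition H_inner :: "complex ^ 'f::{finite,field} \<Rightarrow> complex ^ 'f::{finite,field} \<Rightarrow> complex" where
  "H_inner f g = (\<Sum>x\<in>nonzero_elems. f $ x * cnj (g $ x))"

definition bessel_vector ::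
  "('f::{finite,field} \<Rightarrow> 'l::field) \<Rightarrow> ('l \<Rightarrow> complex) \<Rightarrow> ('f \<Rightarrow> 'l) \<Rightarrow> 'f \<Rightarrow> 'f \<Rightarrow> complex ^ 'f::{finite,field}" where
  "bessel_vector emb \<pi> \<theta> a y =
     (\<chi> v. if v = 0 then 0 else add_char (a * v) * bessel emb \<pi> (\<theta> y * \<theta> v))"

definition delta_vector :: "'f::{finite,field} \<Rightarrow> complex ^ 'f::{finite,field}" where
  "delta_vector y = (\<chi> v. if v = y then 1 else 0)"

definition Phi ::
  "('f::{finite,field} \<Rightarrow> 'l::field) \<Rightarrow> ('l \<Rightarrow> complex) \<Rightarrow> ('f \<Rightarrow> 'l) \<Rightarrow> (complex ^ 'f::{finite,field}) set" where
  "Phi emb \<pi> \<theta> =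
     {bessel_vector emb \<pi> \<theta> a y | a y. y \<noteq> 0} \<union> {delta_vector y | y. y \<noteq> 0}"

definition line_system ::
  "('f::{finite,field} \<Rightarrow> 'l::field) \<Rightarrow> ('l \<Rightarrow> complex) \<Rightarrow> ('f \<Rightarrow> 'l) \<Rightarrow> (complex ^ 'f::{finite,field}) set set" where
  "line_system emb \<pi> \<theta> = {vec.span {u} | u. u \<in> Phi emb \<pi> \<theta>}"

text \<open>
  The modulus of the inner product does not depend on the unit vectors representing the two
  lines, so all choices of unit vectors are admitted.
\<close>

definition angle_set :: "(complex ^ 'f::{finite,field}) set set \<Rightarrow> real set" where
  "angle_set LL =
     {cmod (H_inner u w) | u w U W. U \<in> LL \<and> W \<in> LL \<and> U \<noteq> W \<and> u \<in> U \<and> w \<in> W \<and>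
        H_inner u u = 1 \<and> H_inner w w = 1}"

end

theory Submission
  imports Defs
begin

text \<open>
  Write \<open>q\<close> for the order of the base field, \<open>\<chi>\<close> for its additive character \<open>add_char\<close>, \<open>\<eta>\<close> for its
  quadratic character, \<open>G c\<close> for the Gauss sum \<open>\<Sum>u. \<eta> u * \<chi> (c * u)\<close> and \<open>J\<close> for the Bessel function.
  The character of order two admits an elementary description: \<open>\<pi> t = \<eta> (S t + 2)\<close> for \<open>t \<noteq> -1\<close> on the
  circle, where \<open>S\<close> is the trace.  Grouping the circle by traces (lemma \<open>sum_pi_fibre\<close>) gives the closed
  form \<open>J s = G (- s) * (\<chi> (2 * s) - \<chi> (- 2 * s)) / q\<close> for \<open>s\<close> in the base field (lemma \<open>bessel_emb\<close>).
  If \<open>z\<close> has nonsquare norm, then \<open>J z = 0\<close> (lemma \<open>bessel_nonsquare\<close>); if its norm is \<open>s\<^sup>2\<close>, then \<open>z\<close> is \<open>s\<close>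
  times an element of the circle and \<open>J z = \<plusminus> J s\<close>.

  The vanishing says that the vectors indexed by \<open>y\<close> are supported on the square class of \<open>y\<close>, which
  splits the lines into the two halves.  For two Bessel vectors in the same class, \<open>y' = y * r\<^sup>2\<close>, the
  closed form turns the inner product into the difference of two quadratic exponential sums.
  Completing the square evaluates both by one Gauss sum of modulus \<open>sqrt q\<close>, so that the inner product
  has modulus \<open>\<bar>\<chi> x - 1\<bar> / sqrt q\<close> with an explicit \<open>x\<close>; if the two additive twists coincide, the sums
  are linear and orthogonality gives \<open>0\<close> or \<open>1\<close>.  An inner product with a standard basis vector is a
  value of \<open>J\<close> up to a phase and has a modulus of the same form.  All of this holds in every odd
  characteristic \<open>p\<close>, where \<open>\<chi> x\<close> is a \<open>p\<close>-th root of unity.  What is special about \<open>p = 3\<close> is that all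
  nontrivial \<open>p\<close>-th roots of unity are at the same distance \<open>sqrt 3\<close> from \<open>1\<close>, which leaves only the
  angles \<open>0\<close> and \<open>sqrt (3 / q)\<close>.  For \<open>q > 3\<close> the latter is less than \<open>1\<close>, so the \<open>(q + 1) * (q - 1)\<close>
  vectors span pairwise distinct lines.
\<close>

section \<open>Finite fields\<close>

lemma prime_CHAR_finite_field: "prime CHAR('f::{finite,field})"
  by (intro prime_CHAR_semidom finite_imp_CHAR_pos finite)

lemma of_nat_CARD_eq_0: "of_nat CARD('f) = (0::'f::{finite,field})"
proof -
  have "(\<Sum>x\<in>(UNIV::'f set). x + 1) = (\<Sum>x\<in>UNIV. x)"
    by (rule sum.reindex_bij_witness[of _ "\<lambda>x. x - 1" "\<lambda>x. x + 1"]) auto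
  thus ?thesis by (simp add: sum.distrib)
qed

lemma CHAR_eq_prime_base:
  assumes "CARD('f::{finite,field}) = p ^ n" "prime p"
  shows "CHAR('f) = p"
proof -
  have "of_nat p ^ n = (0::'f)"
    using of_nat_CARD_eq_0[where 'f='f] assms(1) by simp
  hence "of_nat p = (0::'f)" by simp
  hence "CHAR('f) dvd p" by (simp add: of_nat_eq_0_iff_char_dvd)
  thus ?thesis using assms(2) prime_CHAR_finite_field[where 'f='f]
    by (simp add: primes_dvd_imp_eq)
qed

lemma power_card_field:
  fixes x :: "'a::field"
  assumes fin: "finite (UNIV :: 'a set)"
  shows "x ^ card (UNIV :: 'a set) = x"
proof (cases "x = 0")
  case False
  have "(\<Prod>y\<in>UNIV-{0}. y) = (\<Prod>y\<in>UNIV-{0}. x * y)"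
    by (rule prod.reindex_bij_witness[of _ "\<lambda>y. x * y" "\<lambda>y. y / x"]) (use False in auto)
  also have "\<dots> = x ^ (card (UNIV :: 'a set) - 1) * (\<Prod>y\<in>UNIV-{0}. y)"
    by (simp add: prod.distrib fin)
  finally have "x ^ (card (UNIV :: 'a set) - 1) = 1"
    using fin by simp
  moreover have "card (UNIV :: 'a set) = Suc (card (UNIV :: 'a set) - 1)"
    using finite_UNIV_card_ge_0[OF fin] by simp
  ultimately show ?thesis
    by (metis mult.right_neutral power_Suc)
qed (use finite_UNIV_card_ge_0[OF fin] in simp)

lemma card_power_fixed_points:
  assumes "m \<ge> 2"
  shows "finite {x::'a::field. x ^ m = x}" "card {x::'a. x ^ m = x} \<le> m"
proof -
  define P :: "'a poly" where "P = monom 1 m - monom 1 1"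
  have roots: "{x. poly P x = 0} = {x. x ^ m = x}"
    by (simp add: P_def poly_monom)
  have "coeff P m = 1" using assms by (simp add: P_def)
  hence nz: "P \<noteq> 0" by auto
  have "degree P \<le> m" unfolding P_def
    using assms by (intro degree_diff_le degree_monom_le order.trans[OF degree_monom_le]) auto
  thus "card {x::'a. x ^ m = x} \<le> m"
    using card_poly_roots_bound[OF nz] roots by simp
  show "finite {x::'a::field. x ^ m = x}"
    using poly_roots_finite[OF nz] roots by simp
qed

text \<open>Squaring on a finite group of units containing \<open>- 1\<close> is two-to-one, so the squares form a
  subgroup of index two.  This is used for the multiplicative group of the field and for the
  circle of norm one.\<close>

lemma squares_index_two:
  fixes G :: "'a::field set"
  assumes fin: "finite G" and nz: "0 \<notin> G" and two: "(2::'a) \<noteq> 0"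
    and mult: "\<And>x y. x \<in> G \<Longrightarrow> y \<in> G \<Longrightarrow> x * y \<in> G"
    and inv: "\<And>x. x \<in> G \<Longrightarrow> inverse x \<in> G"
    and neg: "-1 \<in> G"
  defines "S \<equiv> (\<lambda>x. x\<^sup>2) ` G"
  shows card_squares: "card G = 2 * card S"
    and nonsquare_mult_nonsquare: "\<And>a b. a \<in> G - S \<Longrightarrow> b \<in> G - S \<Longrightarrow> a * b \<in> S"
proof -
  have uminus: "-x \<in> G" if "x \<in> G" for x
    using mult[OF neg that] by simp
  have fibre: "card {x \<in> G. x\<^sup>2 = y} = 2" if y: "y \<in> S" for y
  proof -
    obtain z where z: "z \<in> G" "y = z\<^sup>2" using y by (auto simp: S_def)
    have "z \<noteq> 0" using z nz by auto
    hence "z \<noteq> -z" using two by (metis add_eq_0_iff mult_2 no_zero_divisors)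
    moreover have "{x \<in> G. x\<^sup>2 = y} = {z, -z}"
      using z uminus by (auto simp: power2_eq_iff)
    ultimately show ?thesis by simp
  qed
  have "card G = (\<Sum>y\<in>S. card {x \<in> G. x\<^sup>2 = y})"
    using sum.image_gen[OF fin, of "\<lambda>_. 1::nat" "\<lambda>x. x\<^sup>2"] by (simp add: S_def)
  also have "\<dots> = 2 * card S" by (simp add: fibre)
  finally show card: "card G = 2 * card S" .
  fix a b assume a: "a \<in> G - S" and b: "b \<in> G - S"
  have SG: "S \<subseteq> G" using mult by (auto simp: S_def power2_eq_square)
  have a0: "a \<noteq> 0" using a nz by auto
  have "(*) a ` S \<subseteq> G - S"
  proof safe
    fix s assume s: "s \<in> S"
    show "a * s \<in> G" using a s SG mult by auto
    assume "a * s \<in> S"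
    then obtain x z where x: "x \<in> G" "s = x\<^sup>2" and z: "z \<in> G" "a * x\<^sup>2 = z\<^sup>2"
      using s by (auto simp: S_def)
    have "x \<noteq> 0" using x nz by auto
    hence "a = (z * inverse x)\<^sup>2" using z by (simp add: field_simps)
    hence "a \<in> S" unfolding S_def using mult inv x z by blast
    thus False using a by simp
  qed
  moreover have "card ((*) a ` S) = card S"
    using a0 by (intro card_image) (auto simp: inj_on_def)
  moreover have "card (G - S) = card S"
    using card card_Diff_subset[OF finite_subset[OF SG fin] SG] by simp
  ultimately have "(*) a ` S = G - S"
    using fin by (intro card_subset_eq) auto
  then obtain x where "x \<in> G" "b = a * x\<^sup>2" using b by (force simp: S_def)
  hence "a * b = (a * x)\<^sup>2" "a * x \<in> G"
    using mult a by (auto simp: power2_eq_square)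
  thus "a * b \<in> S" by (auto simp: S_def)
qed

definition quad_char :: "'f::{finite,field} \<Rightarrow> complex" where
  "quad_char x = (if x = 0 then 0 else if \<exists>y. x = y\<^sup>2 then 1 else -1)"

lemma quad_char_0 [simp]: "quad_char 0 = 0"
  by (simp add: quad_char_def)

lemma quad_char_square: "x \<noteq> 0 \<Longrightarrow> quad_char (x\<^sup>2) = 1"
  by (auto simp: quad_char_def)

lemma quad_char_cases: "x \<noteq> 0 \<Longrightarrow> quad_char x = 1 \<or> quad_char x = -1"
  by (auto simp: quad_char_def)

lemma quad_char_squared: "x \<noteq> 0 \<Longrightarrow> quad_char x * quad_char x = 1"
  using quad_char_cases by fastforce

lemma cnj_quad_char [simp]: "cnj (quad_char x) = quad_char x"
  by (auto simp: quad_char_def)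

lemma QR_eq_squares: "QR = (\<lambda>x. x\<^sup>2) ` (UNIV - {0::'f::field})"
  by (auto simp: QR_def)

lemma quad_char_mult:
  fixes x y :: "'f::{finite,field}"
  assumes two: "(2::'f) \<noteq> 0"
  shows "quad_char (x * y) = quad_char x * quad_char y"
proof (cases "x = 0 \<or> y = 0")
  case False
  hence x: "x \<noteq> 0" and y: "y \<noteq> 0" by auto
  have nn: "a * b \<in> QR" if "a \<in> UNIV - {0} - QR" "b \<in> UNIV - {0} - QR" for a b :: 'f
    using nonsquare_mult_nonsquare[of "UNIV - {0::'f}" a b] that two
    by (auto simp: QR_eq_squares)
  have sq: "a * b \<in> QR \<longleftrightarrow> b \<in> QR" if "a \<in> QR" for a b :: 'f
  proof -
    obtain r where r: "a = r\<^sup>2" "r \<noteq> 0" using \<open>a \<in> QR\<close> by (auto simp: QR_def)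
    have "\<exists>z. b = z\<^sup>2" if "r\<^sup>2 * b = w\<^sup>2" for w
      using that r by (intro exI[of _ "w / r"]) (simp add: field_simps)
    moreover have "\<exists>z. r\<^sup>2 * w\<^sup>2 = z\<^sup>2" for w
      by (intro exI[of _ "r * w"]) (simp add: power_mult_distrib)
    ultimately show ?thesis using r by (auto simp: QR_def)
  qed
  have Q: "quad_char a = (if a \<in> QR then 1 else -1)" if "a \<noteq> 0" for a :: 'f
    using that by (simp add: quad_char_def QR_def)
  show ?thesis
    using nn[of x y] sq[of x y] sq[of y x] x y by (simp add: Q mult.commute)
qed auto

lemma card_QR:
  assumes two: "(2::'f::{finite,field}) \<noteq> 0"
  shows "2 * card (QR :: 'f set) = CARD('f) - 1" "2 * card (NQR :: 'f set) = CARD('f) - 1"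
proof -
  have eq: "card (UNIV - {0::'f}) = CARD('f) - 1" by (simp add: card_Diff_subset)
  show QR: "2 * card (QR :: 'f set) = CARD('f) - 1"
    using card_squares[of "UNIV - {0::'f}"] two eq by (simp add: QR_eq_squares)
  have "(NQR :: 'f set) = (UNIV - {0}) - QR" by (auto simp: QR_def NQR_def)
  moreover have "(QR :: 'f set) \<subseteq> UNIV - {0}" by (auto simp: QR_def)
  ultimately have "card (NQR :: 'f set) = (CARD('f) - 1) - card (QR :: 'f set)"
    using eq by (metis card_Diff_subset finite)
  thus "2 * card (NQR :: 'f set) = CARD('f) - 1" using QR by linarith
qed

text \<open>An element \<open>u\<close> has \<open>1 + quad_char u\<close> square roots.\<close>

lemma sum_over_squares:
  fixes g :: "'f::{finite,field} \<Rightarrow> complex"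
  assumes two: "(2::'f) \<noteq> 0"
  shows "(\<Sum>s\<in>UNIV. g (s\<^sup>2)) = (\<Sum>u\<in>UNIV. (1 + quad_char u) * g u)"
proof -
  have fibre: "of_nat (card {s. s\<^sup>2 = u}) = 1 + quad_char u" for u :: 'f
  proof (cases "u \<noteq> 0 \<and> (\<exists>z. u = z\<^sup>2)")
    case True
    then obtain z where z: "u = z\<^sup>2" "z \<noteq> 0" by auto
    have "z \<noteq> -z" using z two by (metis add_eq_0_iff mult_2 no_zero_divisors)
    moreover have "{s. s\<^sup>2 = u} = {z, -z}" using z by (auto simp: power2_eq_iff)
    ultimately show ?thesis using z by (simp add: quad_char_square)
  next
    case False
    show ?thesis
    proof (cases "u = 0")
      case False
      with \<open>\<not> (u \<noteq> 0 \<and> (\<exists>z. u = z\<^sup>2))\<close> have "{s. s\<^sup>2 = u} = {}" "quad_char u = -1"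
        by (auto simp: quad_char_def)
      thus ?thesis by (simp only: card.empty) simp
    qed simp
  qed
  have "(\<Sum>s\<in>UNIV. g (s\<^sup>2)) = (\<Sum>u\<in>UNIV. \<Sum>s\<in>{s\<in>UNIV. s\<^sup>2 = u}. g (s\<^sup>2))"
    by (rule sum.group[symmetric]) auto
  also have "\<dots> = (\<Sum>u\<in>UNIV. of_nat (card {s. s\<^sup>2 = u}) * g u)"
    by (intro sum.cong) auto
  finally show ?thesis by (simp add: fibre)
qed

section \<open>The additive character and quadratic Gauss sums\<close>

definition gauss_sum :: "'f::{finite,field} \<Rightarrow> complex" where
  "gauss_sum c = (\<Sum>u\<in>UNIV. quad_char u * add_char (c * u))"

context
  fixes n :: nat
  assumes card_power: "CARD('f::{finite,field}) = CHAR('f) ^ n"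
begin

lemma CHAR_ge_2: "CHAR('f) \<ge> 2"
  using prime_ge_2_nat[OF prime_CHAR_finite_field] .

lemma abs_degree_eq: "abs_degree TYPE('f) = n"
  unfolding abs_degree_def
proof (rule the_equality)
  fix m assume "CARD('f) = CHAR('f) ^ m"
  thus "m = n" using card_power CHAR_ge_2 by simp
qed (fact card_power)

lemma degree_pos: "n > 0"
proof (rule ccontr)
  assume "\<not> n > 0"
  hence "CARD('f) = 1" using card_power by simp
  moreover have "card {0, 1::'f} \<le> CARD('f)" by (intro card_mono) auto
  ultimately show False by simp
qed

lemma abs_trace_add: "abs_trace (x + y :: 'f) = abs_trace x + abs_trace y"
  unfolding abs_trace_def
  by (simp add: freshmans_dream'[OF prime_CHAR_finite_field refl] sum.distrib)

lemma inj_on_of_nat_CHAR: "inj_on (of_nat :: nat \<Rightarrow> 'f) {..<CHAR('f)}"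
proof (rule linorder_inj_onI)
  fix i j assume "i < j" "i \<in> {..<CHAR('f)}" "j \<in> {..<CHAR('f)}"
  thus "of_nat i \<noteq> (of_nat j :: 'f)"
    by (subst of_nat_eq_iff_char_dvd) (auto dest: dvd_imp_le)
qed auto

text \<open>The elements \<open>of_nat m\<close> provide \<open>p\<close> roots of \<open>X\<^sup>p - X\<close>, which has no more.\<close>

lemma prime_field_eq: "{x::'f. x ^ CHAR('f) = x} = of_nat ` {..<CHAR('f)}"
proof -
  have "of_nat m ^ CHAR('f) = (of_nat m :: 'f)" for m
    using CHAR_ge_2
    by (induction m) (simp_all add: freshmans_dream[OF prime_CHAR_finite_field refl])
  hence sub: "of_nat ` {..<CHAR('f)} \<subseteq> {x::'f. x ^ CHAR('f) = x}" by auto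
  have "card (of_nat ` {..<CHAR('f)} :: 'f set) = CHAR('f)"
    by (simp add: card_image inj_on_of_nat_CHAR)
  thus ?thesis
    using card_power_fixed_points[OF CHAR_ge_2, where 'a='f] sub
    by (metis card_subset_eq card_mono order_antisym)
qed

text \<open>Raising the trace to the power \<open>p\<close> permutes its summands cyclically.\<close>

lemma abs_trace_in_prime_field: "\<exists>m<CHAR('f). abs_trace (x::'f) = of_nat m"
proof -
  have "abs_trace x ^ CHAR('f) = (\<Sum>i<n. x ^ (CHAR('f) ^ Suc i))"
    unfolding abs_trace_def abs_degree_eq
    by (subst freshmans_dream_sum[OF prime_CHAR_finite_field refl])
      (simp add: mult.commute flip: power_mult)
  also have "\<dots> = (\<Sum>i<Suc n. x ^ (CHAR('f) ^ i)) - x"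
    by (simp only: sum.lessThan_Suc_shift) simp
  also have "\<dots> = abs_trace x"
    using power_card_field[of x] by (simp add: abs_trace_def abs_degree_eq card_power)
  finally have "abs_trace x \<in> {x. x ^ CHAR('f) = x}" by simp
  thus ?thesis unfolding prime_field_eq by auto
qed

text \<open>Any natural number representing the trace may serve as the exponent, which turns
  additivity of the trace into multiplicativity of the character.\<close>

lemma root_power_CHAR: "exp (2 * complex_of_real pi * \<i> / of_nat CHAR('f)) ^ CHAR('f) = 1"
proof -
  have "CHAR('f) \<noteq> 0" using CHAR_ge_2 by linarith
  thus ?thesis by (simp flip: exp_of_nat_mult)
qed

lemma add_char_eq_root_power:
  assumes "abs_trace (x::'f) = of_nat m"
  shows "add_char x = exp (2 * complex_of_real pi * \<i> / of_nat CHAR('f)) ^ m"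
proof -
  let ?p = "CHAR('f)" let ?w = "exp (2 * complex_of_real pi * \<i> / of_nat ?p)"
  have p: "?p > 0" using CHAR_ge_2 by linarith
  have "?w ^ m = ?w ^ (?p * (m div ?p) + m mod ?p)" by simp
  also have "\<dots> = ?w ^ (m mod ?p)"
    by (simp only: power_add power_mult root_power_CHAR power_one mult_1)
  finally have wm: "?w ^ m = ?w ^ (m mod ?p)" .
  have m: "of_nat (m mod ?p) = (of_nat m :: 'f)"
  proof -
    have "of_nat m = (of_nat (?p * (m div ?p) + m mod ?p) :: 'f)" by simp
    thus ?thesis by (simp only: of_nat_add of_nat_mult of_nat_CHAR mult_zero_left add_0_left)
  qed
  have "prime_residue (abs_trace x) = m mod ?p"
    unfolding prime_residue_def
  proof (rule the_equality)
    show "m mod ?p < ?p \<and> of_nat (m mod ?p) = abs_trace x"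
      using m assms p by simp
    fix j assume j: "j < ?p \<and> of_nat j = abs_trace x"
    hence "of_nat j = (of_nat (m mod ?p) :: 'f)" using m assms by simp
    thus "j = m mod ?p"
      using inj_onD[OF inj_on_of_nat_CHAR] j p by simp
  qed
  hence "add_char x = exp (of_nat (m mod ?p) * (2 * complex_of_real pi * \<i> / of_nat ?p))"
    by (simp add: add_char_def mult_ac)
  hence "add_char x = ?w ^ (m mod ?p)"
    by (simp only: exp_of_nat_mult)
  thus ?thesis using wm by simp
qed

lemma add_char_add: "add_char (x + y :: 'f) = add_char x * add_char y"
proof -
  obtain i j where ij: "abs_trace x = of_nat i" "abs_trace y = of_nat j"
    using abs_trace_in_prime_field by metis
  hence "abs_trace (x + y) = of_nat (i + j)" by (simp add: abs_trace_add)
  thus ?thesis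
    using ij[THEN add_char_eq_root_power] add_char_eq_root_power[of "x + y" "i + j"]
    by (simp only: power_add)
qed

lemma norm_add_char [simp]: "norm (add_char (x::'f)) = 1"
  by (simp add: add_char_def norm_exp_eq_Re)

lemma add_char_0 [simp]: "add_char (0::'f) = 1"
proof -
  have "abs_trace (0::'f) = of_nat 0"
    using abs_trace_add[of 0 0] by (metis add.right_neutral add_left_cancel of_nat_0)
  from add_char_eq_root_power[OF this] show ?thesis by simp
qed

lemma add_char_minus: "add_char (- x :: 'f) = cnj (add_char x)"
proof -
  have "add_char x * add_char (- x) = 1" by (simp flip: add_char_add)
  moreover have "add_char x * cnj (add_char x) = 1"
    by (simp add: complex_norm_square[symmetric])
  ultimately have "add_char x * add_char (- x) = add_char x * cnj (add_char x)" by simp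
  moreover have "add_char x \<noteq> 0" using norm_add_char[of x] by force
  ultimately show ?thesis by simp
qed

lemma add_char_power_CHAR: "add_char (x::'f) ^ CHAR('f) = 1"
proof -
  let ?w = "exp (2 * complex_of_real pi * \<i> / of_nat CHAR('f))"
  obtain m where "abs_trace x = of_nat m" using abs_trace_in_prime_field by blast
  hence "add_char x ^ CHAR('f) = (?w ^ m) ^ CHAR('f)" by (simp only: add_char_eq_root_power)
  also have "\<dots> = (?w ^ CHAR('f)) ^ m" by (simp only: mult.commute flip: power_mult)
  finally show ?thesis by (simp only: root_power_CHAR power_one)
qed

text \<open>The trace is a polynomial of degree less than \<open>q\<close>, so it does not vanish identically.\<close>

lemma add_char_nontrivial: "\<exists>x::'f. add_char x \<noteq> 1"
proof -
  let ?p = "CHAR('f)"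
  define P :: "'f poly" where "P = (\<Sum>i<n. monom 1 (?p ^ i))"
  have poly: "poly P x = abs_trace x" for x
    by (simp add: P_def poly_sum poly_monom abs_trace_def abs_degree_eq)
  have "coeff P 1 = (\<Sum>i<n. if i = 0 then 1 else 0)"
    unfolding P_def coeff_sum using CHAR_ge_2
    by (intro sum.cong refl) (auto simp: coeff_monom power_eq_1_iff)
  hence "coeff P 1 = 1" using degree_pos by simp
  hence nz: "P \<noteq> 0" by auto
  have "degree P \<le> ?p ^ (n - 1)" unfolding P_def
    using CHAR_ge_2
    by (intro degree_sum_le order.trans[OF degree_monom_le] power_increasing) auto
  also have "\<dots> < ?p ^ n" using CHAR_ge_2 degree_pos by (intro power_strict_increasing) auto
  finally have "card {x. poly P x = 0} < CARD('f)"
    using card_poly_roots_bound[OF nz] card_power by linarith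
  hence "{x. poly P x = 0} \<noteq> UNIV" by auto
  then obtain x :: 'f where x: "abs_trace x \<noteq> 0" using poly by auto
  obtain m where m: "m < ?p" "abs_trace x = of_nat m"
    using abs_trace_in_prime_field by blast
  have "\<not> ?p dvd m" using m x by (auto dest: dvd_imp_le)
  hence "exp (2 * complex_of_real pi * \<i> * (of_nat m / of_nat ?p)) \<noteq> 1"
    using complex_root_unity_eq_1[of ?p m] CHAR_ge_2 by simp
  hence "add_char x \<noteq> 1"
    using m by (simp add: add_char_eq_root_power mult_ac flip: exp_of_nat_mult)
  thus ?thesis by blast
qed

lemma sum_add_char: "(\<Sum>x\<in>UNIV. add_char (c * x)) = (if c = (0::'f) then of_nat CARD('f) else 0)"
proof (cases "c = 0")
  case False
  obtain a :: 'f where a: "add_char a \<noteq> 1" using add_char_nontrivial by blast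
  have "(\<Sum>x\<in>UNIV. add_char (c * x)) = (\<Sum>x\<in>UNIV. add_char (c * (x + a / c)))"
    by (rule sum.reindex_bij_witness[of _ "\<lambda>x. x + a / c" "\<lambda>x. x - a / c"]) auto
  also have "\<dots> = (\<Sum>x\<in>UNIV. add_char (c * x)) * add_char a"
    using False by (simp add: distrib_left add_char_add sum_distrib_right)
  finally show ?thesis using a False by (metis mult_cancel_left mult.right_neutral)
qed simp

context
  assumes two: "(2::'f) \<noteq> 0"
begin

lemma gauss_sum_mult:
  assumes r: "(r::'f) \<noteq> 0"
  shows "gauss_sum (r * c) = quad_char r * gauss_sum c"
proof -
  have "gauss_sum (r * c) = (\<Sum>u\<in>UNIV. quad_char r * (quad_char u * add_char (c * u)))"
    unfolding gauss_sum_def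
  proof (rule sum.reindex_bij_witness[of _ "\<lambda>u. u / r" "\<lambda>u. r * u"])
    fix u :: 'f
    have "quad_char r * quad_char (r * u) = quad_char u"
      using r by (simp add: quad_char_mult[OF two] quad_char_squared flip: mult.assoc)
    thus "quad_char r * (quad_char (r * u) * add_char (c * (r * u)))
        = quad_char u * add_char (r * c * u)"
      by (simp add: mult_ac)
  qed (use r in auto)
  thus ?thesis by (simp add: gauss_sum_def sum_distrib_left)
qed

text \<open>By counting square roots, the sum is \<open>\<Sum>u. (1 + quad_char u) * add_char (c * u)\<close>, and the first
  part vanishes by orthogonality.\<close>

lemma sum_add_char_square:
  assumes "(c::'f) \<noteq> 0"
  shows "(\<Sum>s\<in>UNIV. add_char (c * s\<^sup>2)) = gauss_sum c"
  using sum_over_squares[OF two, of "\<lambda>u. add_char (c * u)"] sum_add_char[of c] assms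
  by (simp add: gauss_sum_def distrib_right sum.distrib)

lemma four_neq_0: "(4::'f) \<noteq> 0"
  using two by (metis mult_2 numeral_Bit0 mult_eq_0_iff)

text \<open>Substituting \<open>s = t + h\<close> in the double sum makes the summation over \<open>t\<close> an orthogonality
  relation that only leaves \<open>h = 0\<close>.\<close>

lemma gauss_sum_times_cnj:
  assumes c: "(c::'f) \<noteq> 0"
  shows "gauss_sum c * cnj (gauss_sum c) = of_nat CARD('f)"
proof -
  have "gauss_sum c * cnj (gauss_sum c)
      = (\<Sum>t\<in>UNIV. \<Sum>s\<in>UNIV. add_char (c * s\<^sup>2) * add_char (- (c * t\<^sup>2)))"
    unfolding sum_add_char_square[OF c, symmetric]
    by (simp add: sum_product add_char_minus) (rule sum.swap)
  also have "\<dots> = (\<Sum>t\<in>UNIV. \<Sum>h\<in>UNIV. add_char (c * h\<^sup>2) * add_char (2 * c * h * t))"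
  proof (rule sum.cong[OF refl], rule sum.reindex_bij_witness)
    fix s t :: 'f
    show "add_char (c * (s - t)\<^sup>2) * add_char (2 * c * (s - t) * t)
        = add_char (c * s\<^sup>2) * add_char (- (c * t\<^sup>2))"
      unfolding add_char_add[symmetric]
      by (rule arg_cong[of _ _ add_char]) (simp add: power2_eq_square algebra_simps)
    show "(s - t) + t = s" by simp
  qed auto
  also have "\<dots> = (\<Sum>h\<in>UNIV. add_char (c * h\<^sup>2) * (\<Sum>t\<in>UNIV. add_char (2 * c * h * t)))"
    by (subst sum.swap) (simp add: sum_distrib_left)
  also have "\<dots> = (\<Sum>h\<in>(UNIV::'f set). if h = 0 then of_nat CARD('f) else 0)"
    using c two by (intro sum.cong refl) (simp add: sum_add_char)
  finally show ?thesis by simp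
qed

lemma norm_gauss_sum:
  assumes "(c::'f) \<noteq> 0"
  shows "norm (gauss_sum c) = sqrt (real CARD('f))"
proof -
  have "complex_of_real ((norm (gauss_sum c))\<^sup>2) = complex_of_real (real CARD('f))"
    using gauss_sum_times_cnj[OF assms] by (simp only: complex_norm_square of_real_of_nat_eq)
  hence "(norm (gauss_sum c))\<^sup>2 = real CARD('f)" by (simp only: of_real_eq_iff)
  thus ?thesis by (simp add: real_sqrt_unique)
qed

text \<open>Completing the square: the shift \<open>d = b / (2 * c)\<close> removes the linear term.\<close>

lemma sum_add_char_quadratic:
  assumes c: "(c::'f) \<noteq> 0"
  shows "(\<Sum>s\<in>UNIV. add_char (c * s\<^sup>2 + b * s)) = add_char (- b\<^sup>2 / (4 * c)) * gauss_sum c"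
proof -
  obtain d where b: "b = 2 * c * d"
    using c two by (intro that[of "b / (2 * c)"]) simp
  have "(2 * c * d)\<^sup>2 = (c * d\<^sup>2) * (4 * c)" by (simp add: power2_eq_square)
  hence b2: "- b\<^sup>2 / (4 * c) = - (c * d\<^sup>2)" using c four_neq_0 by (simp add: b)
  have "(\<Sum>s\<in>UNIV. add_char (c * s\<^sup>2 + b * s))
      = (\<Sum>s\<in>UNIV. add_char (- (c * d\<^sup>2)) * add_char (c * s\<^sup>2))"
  proof (rule sum.reindex_bij_witness[of _ "\<lambda>s. s - d" "\<lambda>s. s + d"])
    fix s :: 'f
    have "- (c * d\<^sup>2) + c * (s + d)\<^sup>2 = c * s\<^sup>2 + b * s"
      by (simp add: b power2_eq_square algebra_simps)
    thus "add_char (- (c * d\<^sup>2)) * add_char (c * (s + d)\<^sup>2) = add_char (c * s\<^sup>2 + b * s)"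
      by (simp flip: add_char_add)
  qed auto
  thus ?thesis
    by (simp only: sum_add_char_square[OF c] b2 sum_distrib_left[symmetric])
qed

end

end

section \<open>The quadratic extension and its norm-one circle\<close>

text \<open>The exponent \<open>n\<close> is the absolute degree of the base field.\<close>

locale finite_quadratic_extension =
  fixes emb :: "'f::{finite,field} \<Rightarrow> 'l::field" and n :: nat
  assumes card_power: "CARD('f) = CHAR('f) ^ n"
    and two_neq_0: "(2::'f) \<noteq> 0"
    and ext: "quadratic_extension emb"
begin

lemma emb_1 [simp]: "emb 1 = 1"
  and emb_add: "emb (x + y) = emb x + emb y"
  and emb_mult: "emb (x * y) = emb x * emb y"
  using ext by (auto simp: quadratic_extension_def)

lemma emb_0 [simp]: "emb 0 = 0"
  using emb_add[of 0 0] by (metis add.right_neutral add_left_cancel)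

lemma emb_minus: "emb (- x) = - emb x"
  using emb_add[of x "-x"] by (simp add: eq_neg_iff_add_eq_0 add.commute)

lemma emb_diff: "emb (x - y) = emb x - emb y"
  using emb_add[of x "-y"] by (simp add: emb_minus)

lemma emb_power: "emb (x ^ m) = emb x ^ m"
  by (induction m) (simp_all add: emb_mult)

lemma emb_of_nat: "emb (of_nat m) = of_nat m"
  by (induction m) (simp_all add: emb_add)

lemma emb_numeral: "emb (numeral m) = numeral m"
  using emb_of_nat[of "numeral m"] by simp

lemma emb_eq_0_iff [simp]: "emb x = 0 \<longleftrightarrow> x = 0"
proof
  assume "emb x = 0"
  hence "emb (x * inverse x) = 0" by (simp add: emb_mult)
  thus "x = 0" by (cases "x = 0") auto
qed simp

lemma emb_eq_iff [simp]: "emb x = emb y \<longleftrightarrow> x = y"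
  using emb_eq_0_iff[of "x - y"] by (simp add: emb_diff)

lemma inj_emb: "inj emb"
  by (simp add: inj_def)

lemma emb_divide: "emb (x / y) = emb x / emb y"
proof (cases "y = 0")
  case False
  have "emb (x / y * y) = emb (x / y) * emb y" by (rule emb_mult)
  thus ?thesis using False by (simp add: field_simps)
qed simp

lemma two_neq_0': "(2::'l) \<noteq> 0"
  using emb_eq_0_iff[of 2] two_neq_0 by (simp add: emb_numeral)

lemma CHAR_extension: "CHAR('l) = CHAR('f)"
proof (rule CHAR_eqI)
  show "of_nat CHAR('f) = (0::'l)" using emb_of_nat[of "CHAR('f)"] by simp
  fix m assume "of_nat m = (0::'l)"
  hence "of_nat m = (0::'f)" using emb_of_nat[of m] by (metis emb_eq_0_iff)
  thus "CHAR('f) dvd m" by (simp add: of_nat_eq_0_iff_char_dvd)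
qed

text \<open>Coordinates with respect to a two-element basis biject with pairs over the base field.\<close>

lemma finite_extension: "finite (UNIV :: 'l set)"
  and card_extension: "card (UNIV :: 'l set) = CARD('f) ^ 2"
proof -
  interpret V: vector_space "\<lambda>a z. emb a * z"
    by unfold_locales (auto simp: emb_add emb_mult algebra_simps)
  have dim: "V.dim UNIV = 2" using ext by (simp add: quadratic_extension_def)
  obtain B where B: "V.independent B" "UNIV \<subseteq> V.span B" "card B = V.dim UNIV"
    using V.basis_exists[of UNIV] by metis
  then obtain a b where ab: "B = {a, b}" "a \<noteq> b"
    using dim by (metis card_2_iff)
  let ?f = "\<lambda>(x, y). emb x * a + emb y * b"
  have "UNIV = range (\<lambda>u. \<Sum>v\<in>B. emb (u v) * v)"
    using B V.span_finite[of B] ab by auto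
  also have "\<dots> \<subseteq> range ?f" using ab by (auto intro!: image_eqI[of _ _ "(_, _)"])
  finally have range: "range ?f = UNIV" by auto
  have indep: "x = 0 \<and> y = 0" if "emb x * a + emb y * b = 0" for x y
  proof -
    define u where "u = (\<lambda>v. if v = a then x else y)"
    have "(\<Sum>v\<in>B. emb (u v) * v) = 0" using ab that by (simp add: u_def)
    hence "\<forall>v\<in>B. u v = 0" using B V.dependent_finite[of B] ab by auto
    thus ?thesis using ab by (auto simp: u_def)
  qed
  have "inj ?f"
  proof (rule injI, clarify)
    fix x y x' y' assume "emb x * a + emb y * b = emb x' * a + emb y' * b"
    hence "emb (x - x') * a + emb (y - y') * b = 0" by (simp add: emb_diff algebra_simps)
    from indep[OF this] show "x = x' \<and> y = y'" by simp
  qed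
  hence bij: "bij ?f" using range by (simp add: bij_def)
  show "finite (UNIV :: 'l set)" using range by (metis finite finite_imageI)
  show "card (UNIV :: 'l set) = CARD('f) ^ 2"
    using bij_betw_same_card[OF bij] by (simp add: power2_eq_square card_prod)
qed

lemma frob_add: "(x + y :: 'l) ^ CARD('f) = x ^ CARD('f) + y ^ CARD('f)"
proof (rule freshmans_dream')
  show "prime CHAR('l)" using prime_CHAR_finite_field[where 'f='f] by (simp add: CHAR_extension)
  show "CARD('f) = CHAR('l) ^ n" by (simp add: CHAR_extension card_power)
qed

lemma CARD_ge_2: "CARD('f) \<ge> 2"
proof -
  have "card {0, 1::'f} \<le> CARD('f)" by (intro card_mono) auto
  thus ?thesis by simp
qed

lemma frob_emb [simp]: "(emb x) ^ CARD('f) = emb x"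
  using power_card_field[of x] by (simp flip: emb_power)

lemma frob_frob [simp]: "((z::'l) ^ CARD('f)) ^ CARD('f) = z"
  using power_card_field[OF finite_extension, of z]
  by (simp add: card_extension power2_eq_square power_mult)

text \<open>The base field already supplies \<open>q\<close> roots of \<open>X\<^sup>q - X\<close>.\<close>

lemma frob_eq_iff_range: "z ^ CARD('f) = z \<longleftrightarrow> z \<in> range emb"
proof -
  have "range emb \<subseteq> {z. z ^ CARD('f) = z}" by auto
  moreover have "card (range emb) = CARD('f)" by (simp add: card_image inj_emb)
  ultimately have "range emb = {z. z ^ CARD('f) = z}"
    using card_power_fixed_points[OF CARD_ge_2, where 'a='l]
    by (metis card_subset_eq card_mono order_antisym)
  thus ?thesis by auto
qed

lemma emb_rel_norm: "emb (rel_norm emb z) = z * z ^ CARD('f)"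
proof -
  have "(z * z ^ CARD('f)) ^ CARD('f) = z * z ^ CARD('f)" by (simp add: power_mult_distrib mult.commute)
  hence "z ^ (CARD('f) + 1) \<in> range emb" by (simp add: frob_eq_iff_range)
  thus ?thesis by (simp add: rel_norm_def f_inv_into_f)
qed

lemma emb_rel_trace: "emb (rel_trace emb z) = z + z ^ CARD('f)"
proof -
  have "(z + z ^ CARD('f)) ^ CARD('f) = z + z ^ CARD('f)" by (simp add: frob_add add.commute)
  hence "z + z ^ CARD('f) \<in> range emb" by (simp add: frob_eq_iff_range)
  thus ?thesis by (simp add: rel_trace_def f_inv_into_f)
qed

lemma rel_trace_emb_mult: "rel_trace emb (emb s * z) = s * rel_trace emb z"
proof -
  have "emb (rel_trace emb (emb s * z)) = emb (s * rel_trace emb z)"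
    by (simp add: emb_rel_trace emb_mult power_mult_distrib distrib_left)
  thus ?thesis by simp
qed

lemma rel_trace_frob: "rel_trace emb (z ^ CARD('f)) = rel_trace emb z"
proof -
  have "emb (rel_trace emb (z ^ CARD('f))) = emb (rel_trace emb z)"
    by (simp add: emb_rel_trace add.commute)
  thus ?thesis by simp
qed

text \<open>The minimal polynomial of an element outside the base field has a nonsquare discriminant, whose
  square root in the extension is the difference of the two conjugates.  Every other nonsquare is the
  product of this discriminant and a nonzero square.\<close>

lemma ex_sqrt_in_extension: "\<exists>w. w\<^sup>2 = emb d"
proof (cases "d \<in> QR \<or> d = 0")
  case True
  thus ?thesis by (auto simp: QR_def emb_power)
next
  case False
  have "card (range emb) < card (UNIV :: 'l set)"
    using CARD_ge_2 by (simp add: card_image inj_emb card_extension power2_eq_square)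
  then obtain z where z: "z \<notin> range emb" by (metis UNIV_I less_irrefl subsetI subset_antisym top_greatest)
  let ?v = "z - z ^ CARD('f)" and ?D = "(rel_trace emb z)\<^sup>2 - 4 * rel_norm emb z"
  have D: "?v\<^sup>2 = emb ?D"
    by (simp add: emb_diff emb_power emb_mult emb_numeral emb_rel_trace emb_rel_norm
        power2_eq_square algebra_simps)
  have v: "?v \<notin> range emb"
  proof
    assume "?v \<in> range emb"
    then obtain x where x: "?v = emb x" by auto
    have "emb ((x + rel_trace emb z) / 2) = z"
      using two_neq_0' by (simp add: emb_divide emb_add emb_numeral emb_rel_trace flip: x)
    thus False using z by (metis rangeI)
  qed
  hence D0: "?D \<noteq> 0" using D by (metis emb_0 power_eq_0_iff rangeI)
  have "?D \<notin> QR"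
  proof
    assume "?D \<in> QR"
    then obtain x where "?D = x\<^sup>2" by (auto simp: QR_def)
    hence "?v = emb x \<or> ?v = emb (- x)" using D by (simp add: emb_power emb_minus power2_eq_iff)
    thus False using v by auto
  qed
  hence "?D * d \<in> QR"
    using nonsquare_mult_nonsquare[of "UNIV - {0::'f}" ?D d] two_neq_0 D0 False
    by (simp add: QR_eq_squares)
  then obtain r where "?D * d = r\<^sup>2" by (auto simp: QR_def)
  hence "?v\<^sup>2 * emb d = (emb r)\<^sup>2" unfolding D by (simp flip: emb_mult emb_power)
  moreover have "?v\<^sup>2 \<noteq> 0" using D D0 by simp
  ultimately have "(emb r / ?v)\<^sup>2 = emb d" by (simp add: power_divide divide_eq_eq mult.commute)
  thus ?thesis by blast
qed

lemma mem_circle: "z \<in> circle emb d \<longleftrightarrow> z * z ^ CARD('f) = emb d"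
  using emb_rel_norm[of z] by (auto simp: circle_def)

lemma circle_neq_0: "z \<in> circle emb d \<Longrightarrow> d \<noteq> 0 \<Longrightarrow> z \<noteq> 0"
  by (auto simp: mem_circle)

lemma circle_mult: "x \<in> circle emb c \<Longrightarrow> y \<in> circle emb d \<Longrightarrow> x * y \<in> circle emb (c * d)"
  by (simp add: mem_circle emb_mult power_mult_distrib mult.assoc mult.left_commute[of y])

lemma circle_divide: "x \<in> circle emb c \<Longrightarrow> y \<in> circle emb d \<Longrightarrow> x / y \<in> circle emb (c / d)"
  by (simp add: mem_circle emb_divide power_divide flip: times_divide_times_eq)

lemma emb_in_circle: "emb s \<in> circle emb (s\<^sup>2)"
  by (simp add: mem_circle emb_mult power2_eq_square)

abbreviation C :: "'l set" where "C \<equiv> circle emb 1"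

lemma one_in_C [simp]: "1 \<in> C" by (simp add: mem_circle)

lemma minus_one_in_C [simp]: "-1 \<in> C"
proof -
  have "(emb (-1)) ^ CARD('f) = emb (-1)" by (rule frob_emb)
  thus ?thesis by (simp add: mem_circle emb_minus)
qed

lemma C_mult: "s \<in> C \<Longrightarrow> t \<in> C \<Longrightarrow> s * t \<in> C"
  using circle_mult[of s 1 t 1] by simp

lemma C_inverse: "t \<in> C \<Longrightarrow> inverse t \<in> C"
  using circle_divide[of 1 1 t 1] by (simp add: inverse_eq_divide)

lemma C_neq_0: "t \<in> C \<Longrightarrow> t \<noteq> 0"
  using circle_neq_0 by force

lemma frob_C: "t \<in> C \<Longrightarrow> t ^ CARD('f) = inverse t"
  by (simp add: mem_circle inverse_unique)

lemma finite_C: "finite C"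
  by (rule finite_subset[OF subset_UNIV finite_extension])

lemma C_range_emb: "t \<in> C \<Longrightarrow> t \<in> range emb \<Longrightarrow> t = 1 \<or> t = -1"
  by (auto simp: mem_circle square_eq_1_iff)

end

section \<open>The Bessel function\<close>

locale quadratic_bessel = finite_quadratic_extension emb n
  for emb :: "'f::{finite,field} \<Rightarrow> 'l::field" and n +
  fixes \<pi> :: "'l \<Rightarrow> complex"
  assumes character: "order_two_character (circle emb 1) \<pi>"
begin

lemma pi_mult: "s \<in> C \<Longrightarrow> t \<in> C \<Longrightarrow> \<pi> (s * t) = \<pi> s * \<pi> t"
  and pi_cases: "t \<in> C \<Longrightarrow> \<pi> t = 1 \<or> \<pi> t = -1"
  and pi_nontrivial: "\<exists>t\<in>C. \<pi> t \<noteq> 1"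
  using character by (auto simp: order_two_character_def)

lemma pi_mult_self: "t \<in> C \<Longrightarrow> \<pi> t * \<pi> t = 1"
  using pi_cases by fastforce

lemma cnj_pi: "t \<in> C \<Longrightarrow> cnj (\<pi> t) = \<pi> t"
  using pi_cases by fastforce

lemma norm_pi: "t \<in> C \<Longrightarrow> norm (\<pi> t) = 1"
  using pi_cases by fastforce

lemma pi_1 [simp]: "\<pi> 1 = 1"
  using pi_mult[of 1 1] pi_cases[of 1] by auto

lemma pi_inverse:
  assumes "t \<in> C"
  shows "\<pi> (inverse t) = \<pi> t"
proof -
  have "\<pi> t * \<pi> (inverse t) = \<pi> t * \<pi> t"
    using pi_mult[OF assms C_inverse[OF assms]] pi_mult_self[OF assms] C_neq_0[OF assms] by simp
  moreover have "\<pi> t \<noteq> 0" using pi_cases[OF assms] by auto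
  ultimately show ?thesis by simp
qed

text \<open>Squares lie in the kernel.  Conversely, an element \<open>s\<close> outside the kernel is a nonsquare, and so is
  \<open>t * s\<close> for \<open>t\<close> in the kernel; were \<open>t\<close> a nonsquare too, \<open>t * s\<close> would be a square.\<close>

lemma pi_eq_1_iff:
  assumes t: "t \<in> C"
  shows "\<pi> t = 1 \<longleftrightarrow> (\<exists>w\<in>C. t = w\<^sup>2)"
proof
  assume "\<exists>w\<in>C. t = w\<^sup>2"
  thus "\<pi> t = 1" using pi_mult pi_mult_self by (auto simp: power2_eq_square)
next
  assume "\<pi> t = 1"
  obtain s where s: "s \<in> C" "\<pi> s = -1" using pi_nontrivial pi_cases by auto
  have sq: "\<pi> x = 1" if "x \<in> (\<lambda>x. x\<^sup>2) ` C" for x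
    using that pi_mult pi_mult_self by (auto simp: power2_eq_square)
  have "s \<notin> (\<lambda>x. x\<^sup>2) ` C" using sq[of s] s by auto
  moreover have "\<pi> (t * s) \<noteq> 1" using \<open>\<pi> t = 1\<close> s t by (simp add: pi_mult)
  ultimately have "t \<in> (\<lambda>x. x\<^sup>2) ` C"
    using nonsquare_mult_nonsquare[of C t s] sq[of "t * s"] s t finite_C C_neq_0 two_neq_0'
      C_mult C_inverse minus_one_in_C by blast
  thus "\<exists>w\<in>C. t = w\<^sup>2" by auto
qed

lemma emb_rel_trace_C: "t \<in> C \<Longrightarrow> emb (rel_trace emb t) = t + inverse t"
  by (simp add: emb_rel_trace frob_C)

text \<open>If \<open>t = w\<^sup>2\<close> on the circle, then \<open>rel_trace emb t + 2\<close> is the square of the trace \<open>w + inverse w\<close>.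
  Conversely, if it is \<open>x\<^sup>2\<close>, then \<open>(t + 1) / x\<close> is a square root of \<open>t\<close> on the circle.\<close>

lemma pi_eq_quad_char:
  assumes t: "t \<in> C" "t \<noteq> -1"
  shows "\<pi> t = quad_char (rel_trace emb t + 2)"
proof -
  let ?u = "rel_trace emb t"
  have t0: "t \<noteq> 0" using t C_neq_0 by auto
  have u2: "emb (?u + 2) = (t + 1) * (inverse t + 1)"
    using t0 by (simp add: emb_rel_trace_C[OF t(1)] emb_add emb_numeral algebra_simps)
  have "inverse t + 1 \<noteq> 0"
    using t(2) by (metis add_eq_0_iff inverse_inverse_eq inverse_minus_eq inverse_1 add.commute)
  hence u20: "?u + 2 \<noteq> 0"
    using u2 t(2) by (metis emb_0 add_eq_0_iff2 mult_eq_0_iff)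
  have "\<pi> t = 1 \<longleftrightarrow> (\<exists>x. ?u + 2 = x\<^sup>2)"
  proof
    assume "\<pi> t = 1"
    then obtain w where w: "w \<in> C" "t = w\<^sup>2" using pi_eq_1_iff t by auto
    have "emb (?u + 2) = (emb (rel_trace emb w))\<^sup>2"
      using w C_neq_0[OF w(1)]
      by (simp add: emb_rel_trace_C C_mult emb_add emb_numeral emb_rel_trace_C[OF t(1)]
          power2_eq_square field_simps)
    thus "\<exists>x. ?u + 2 = x\<^sup>2" by (metis emb_power emb_eq_iff)
  next
    assume "\<exists>x. ?u + 2 = x\<^sup>2"
    then obtain x where x: "?u + 2 = x\<^sup>2" by auto
    hence x0: "emb x \<noteq> 0" using u20 by auto
    define w where "w = (t + 1) / emb x"
    have ux: "(t + 1) * (inverse t + 1) = (emb x)\<^sup>2" using u2 x by (simp add: emb_power)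
    have "w\<^sup>2 = (t + 1)\<^sup>2 / ((t + 1) * (inverse t + 1))"
      by (simp add: w_def power_divide ux)
    also have "\<dots> = t"
      using t t0 \<open>inverse t + 1 \<noteq> 0\<close> by (simp add: power2_eq_square divide_simps) (simp add: algebra_simps)
    finally have "w\<^sup>2 = t" .
    have "w * w ^ CARD('f) = (t + 1) * (inverse t + 1) / (emb x)\<^sup>2"
      using t by (simp add: w_def power_divide frob_add frob_C power2_eq_square)
    also have "\<dots> = 1" using ux x0 by simp
    finally have "w \<in> C" by (simp add: mem_circle)
    thus "\<pi> t = 1" using \<open>w\<^sup>2 = t\<close> pi_eq_1_iff t by auto
  qed
  thus ?thesis using u20 pi_cases[OF t(1)] by (auto simp: quad_char_def)
qed

lemma nonsquare_sqrt_frob: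
  assumes w: "w\<^sup>2 = emb d" and d: "\<not> (\<exists>x. d = x\<^sup>2)"
  shows "w ^ CARD('f) = - w"
proof -
  have "(w ^ CARD('f))\<^sup>2 = w\<^sup>2"
    by (metis frob_emb w power_mult mult.commute)
  moreover have "w ^ CARD('f) \<noteq> w"
    using w d by (auto simp: frob_eq_iff_range simp flip: emb_power)
  ultimately show ?thesis by (simp add: power2_eq_iff)
qed

text \<open>A square root of \<open>-1\<close> in the base field has norm \<open>-1\<close>; one outside the base field is negated by
  conjugation and has norm \<open>1\<close>.\<close>

lemma pi_minus_1: "\<pi> (-1) = - quad_char (-1 :: 'f)"
proof (cases "\<exists>x::'f. -1 = x\<^sup>2")
  case True
  then obtain i :: 'f where i: "i\<^sup>2 = -1" by metis
  have "w \<notin> C" if "w\<^sup>2 = -1" for w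
  proof
    assume "w \<in> C"
    have "w\<^sup>2 = (emb i)\<^sup>2" using that i by (simp add: emb_minus flip: emb_power)
    hence "w = emb i \<or> w = emb (-i)" by (simp add: power2_eq_iff emb_minus)
    hence "w \<in> range emb" by auto
    hence "w = 1 \<or> w = -1" using C_range_emb \<open>w \<in> C\<close> by auto
    hence "(1::'l) = -1" using that by auto
    thus False using two_neq_0' by (metis add.right_inverse one_add_one)
  qed
  hence "\<pi> (-1) \<noteq> 1" using pi_eq_1_iff[of "-1"] by fastforce
  moreover have "i \<noteq> 0" using i by auto
  hence "quad_char (-1::'f) = 1" using quad_char_square[of i] i by simp
  ultimately show ?thesis using pi_cases[of "-1"] by simp
next
  case False
  obtain w where w: "w\<^sup>2 = emb (-1)" using ex_sqrt_in_extension by blast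
  have "w * w ^ CARD('f) = 1"
    using nonsquare_sqrt_frob[OF w False] w by (simp add: power2_eq_square emb_minus)
  hence "w \<in> C" by (simp add: mem_circle)
  hence "\<pi> (-1) = 1" using w pi_eq_1_iff[of "-1"] by (auto simp: emb_minus intro!: bexI[of _ w])
  thus ?thesis using False by (simp add: quad_char_def)
qed

lemma C_trace_quadratic:
  assumes "t \<in> C"
  shows "(2 * t - emb (rel_trace emb t))\<^sup>2 = emb ((rel_trace emb t)\<^sup>2 - 4)"
  using C_neq_0[OF assms]
  by (simp add: emb_diff emb_mult emb_numeral emb_rel_trace_C[OF assms] power2_eq_square field_simps)

text \<open>The elements of the circle with trace \<open>u\<close> are roots of \<open>T\<^sup>2 - u T + 1\<close>, whose discriminant is
  \<open>(u + 2) * (u - 2)\<close>.  If it is a nonzero square, the roots lie in the base field and off the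
  circle; if it is a nonsquare, both roots lie on the circle and \<open>\<pi>\<close> takes the value
  \<open>quad_char (u + 2)\<close> at each.  For \<open>u = 2\<close> and \<open>u = -2\<close> there is only the double root \<open>1\<close> or \<open>-1\<close>.\<close>

lemma sum_pi_fibre:
  "(\<Sum>t | t \<in> C \<and> rel_trace emb t = u. \<pi> t) = quad_char (u + 2) - quad_char (u - 2)"
proof -
  note qm = quad_char_mult[OF two_neq_0]
  have q4: "quad_char (4::'f) = 1"
    using quad_char_square[OF two_neq_0] by simp
  have ends: "t = 1" if "t \<in> C" "rel_trace emb t = 2" for t
    using C_trace_quadratic[OF that(1)] that two_neq_0' by (simp add: emb_numeral)
  have ends': "t = -1" if "t \<in> C" "rel_trace emb t = -2" for t
  proof -
    have "2 * t = 2 * (-1)"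
      using C_trace_quadratic[OF that(1)] that by (simp add: emb_numeral emb_minus eq_neg_iff_add_eq_0)
    thus ?thesis using two_neq_0' by (metis mult_cancel_left)
  qed
  have tr1: "rel_trace emb 1 = 2"
    using emb_rel_trace_C[of 1] by (simp flip: emb_numeral)
  have trm1: "rel_trace emb (-1) = -2"
    using emb_rel_trace_C[of "-1"] by (simp flip: emb_numeral emb_minus)
  have qm1: "quad_char (-4::'f) = quad_char (-1::'f)"
    using qm[of "-1" 4] by (simp add: q4)
  consider "u = 2" | "u = -2" | "u \<noteq> 2" "u \<noteq> -2" by blast
  thus ?thesis
  proof cases
    case 1
    have "{t. t \<in> C \<and> rel_trace emb t = u} = {1}" using ends tr1 1 by auto
    thus ?thesis using 1 q4 by simp
  next
    case 2
    have "{t. t \<in> C \<and> rel_trace emb t = u} = {-1}" using ends' trm1 2 by auto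
    thus ?thesis using 2 pi_minus_1 qm1 by simp
  next
    case 3
    let ?D = "u\<^sup>2 - 4"
    have D: "?D = (u + 2) * (u - 2)" by (simp add: power2_eq_square algebra_simps)
    have u: "u + 2 \<noteq> 0" "u - 2 \<noteq> 0" using 3 by (auto simp: eq_neg_iff_add_eq_0)
    have D0: "?D \<noteq> 0" unfolding D using u by simp
    have qD: "quad_char (u + 2) * quad_char (u - 2) = quad_char ?D"
      by (simp only: D qm)
    show ?thesis
    proof (cases "\<exists>x. ?D = x\<^sup>2")
      case True
      then obtain x where x: "?D = x\<^sup>2" by auto
      have False if t: "t \<in> C" "rel_trace emb t = u" for t
      proof -
        have "(2 * t - emb u)\<^sup>2 = (emb x)\<^sup>2"
          using C_trace_quadratic[OF t(1)] t x by (simp add: emb_power)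
        hence "2 * t - emb u = emb x \<or> 2 * t - emb u = emb (- x)"
          by (simp add: power2_eq_iff emb_minus)
        then obtain y where "2 * t - emb u = emb y" by blast
        hence "t = emb ((y + u) / 2)"
          using two_neq_0' by (simp add: emb_divide emb_add emb_numeral field_simps)
        hence "t = 1 \<or> t = -1" using C_range_emb t by blast
        thus False using t 3 tr1 trm1 by auto
      qed
      hence "{t. t \<in> C \<and> rel_trace emb t = u} = {}" by auto
      moreover have "quad_char (u + 2) * quad_char (u - 2) = 1"
        unfolding qD using True D0 by (simp add: quad_char_def)
      hence "quad_char (u + 2) = quad_char (u - 2)"
        using quad_char_cases[OF u(1)] quad_char_cases[OF u(2)] by auto
      ultimately show ?thesis by (simp only: sum.empty) simp
    next
      case False
      obtain w where w: "w\<^sup>2 = emb ?D" using ex_sqrt_in_extension by blast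
      have wf: "w ^ CARD('f) = - w" by (rule nonsquare_sqrt_frob[OF w False])
      have w0: "w \<noteq> 0" using w u by (auto simp: D)
      define t where "t = (emb u + w) / 2"
      define t' where "t' = (emb u - w) / 2"
      have two_f: "(2::'l) ^ CARD('f) = 2" using frob_emb[of 2] by (simp add: emb_numeral)
      have tf: "t ^ CARD('f) = t'"
        by (simp add: t_def t'_def power_divide frob_add wf two_f)
      hence t'f: "t' ^ CARD('f) = t" using frob_frob[of t] by simp
      have t2: "2 * t = emb u + w" and t'2: "2 * t' = emb u - w"
        using two_neq_0' by (simp_all add: t_def t'_def)
      have "4 * (t * t') = (2 * t) * (2 * t')" by simp
      also have "\<dots> = (emb u)\<^sup>2 - w\<^sup>2"
        unfolding t2 t'2 by (simp add: power2_eq_square algebra_simps)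
      also have "\<dots> = 4" by (simp add: w emb_diff emb_power emb_numeral)
      finally have "2 * (2 * (t * t')) = 2 * (2 * 1)" by simp
      hence "t * t' = 1" using two_neq_0' by (simp only: mult_cancel_left simp_thms)
      hence tC: "t \<in> C" "t' \<in> C" by (simp_all add: mem_circle tf t'f mult.commute)
      have "2 * (t + t') = 2 * emb u" "2 * (t - t') = 2 * w"
        by (simp_all only: distrib_left right_diff_distrib t2 t'2) simp_all
      hence sum: "t + t' = emb u" and diff: "t - t' = w"
        using two_neq_0' by (simp_all only: mult_cancel_left simp_thms)
      have tr: "rel_trace emb t = u" "rel_trace emb t' = u"
        using emb_rel_trace[of t] emb_rel_trace[of t'] sum by (simp_all add: tf t'f add.commute)
      have ne: "t \<noteq> t'" using w0 diff by auto
      have "{t. t \<in> C \<and> rel_trace emb t = u} = {t, t'}"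
      proof (intro equalityI subsetI)
        fix s assume "s \<in> {t. t \<in> C \<and> rel_trace emb t = u}"
        hence "(2 * s - emb u)\<^sup>2 = w\<^sup>2" using C_trace_quadratic[of s] w by auto
        hence "2 * s - emb u = w \<or> 2 * s - emb u = - w" by (simp only: power2_eq_iff)
        hence "2 * s = emb u + w \<or> 2 * s = emb u - w" by (auto simp: algebra_simps)
        hence "2 * s = 2 * t \<or> 2 * s = 2 * t'" by (simp only: t2 t'2)
        thus "s \<in> {t, t'}" using two_neq_0' by (simp only: mult_cancel_left insert_iff) blast
      qed (use tC tr in auto)
      moreover have "t \<noteq> -1" "t' \<noteq> -1" using tr trm1 3(2) by metis+
      hence "\<pi> t = quad_char (u + 2)" "\<pi> t' = quad_char (u + 2)"
        using pi_eq_quad_char[OF tC(1)] pi_eq_quad_char[OF tC(2)] tr by simp_all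
      moreover have "quad_char (u + 2) * quad_char (u - 2) = -1"
        unfolding qD using False D0 by (simp add: quad_char_def)
      hence "quad_char (u - 2) = - quad_char (u + 2)"
        using quad_char_cases[OF u(1)] quad_char_cases[OF u(2)] by auto
      ultimately show ?thesis using ne by simp
    qed
  qed
qed

lemmas char_add = add_char_add[OF card_power]
lemmas char_0 = add_char_0[OF card_power]
lemmas char_minus = add_char_minus[OF card_power]

lemma bessel_circle_mult:
  assumes t: "t \<in> C"
  shows "bessel emb \<pi> (t * z) = \<pi> t * bessel emb \<pi> z"
proof -
  have t0: "t \<noteq> 0" using t C_neq_0 by auto
  have "(\<Sum>s\<in>C. add_char (- rel_trace emb (s * (t * z))) * \<pi> s)
      = (\<Sum>s\<in>C. \<pi> t * (add_char (- rel_trace emb (s * z)) * \<pi> s))"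
  proof (rule sum.reindex_bij_witness[of _ "\<lambda>s. s * inverse t" "\<lambda>s. s * t"])
    fix s assume s: "s \<in> C"
    have "\<pi> t * (add_char (- rel_trace emb (s * t * z)) * \<pi> (s * t)) =
        add_char (- rel_trace emb (s * (t * z))) * \<pi> s * (\<pi> t * \<pi> t)"
      by (simp only: pi_mult[OF s t] mult.assoc mult.left_commute mult.commute)
    thus "\<pi> t * (add_char (- rel_trace emb (s * t * z)) * \<pi> (s * t)) =
         add_char (- rel_trace emb (s * (t * z))) * \<pi> s"
      by (simp only: pi_mult_self[OF t] mult_1_right)
  qed (use t t0 in \<open>auto intro: C_mult C_inverse\<close>)
  thus ?thesis by (simp add: bessel_def sum_distrib_left mult_ac)
qed

lemma bessel_frob: "bessel emb \<pi> (z ^ CARD('f)) = bessel emb \<pi> z"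
proof -
  have "(\<Sum>s\<in>C. add_char (- rel_trace emb (s * z ^ CARD('f))) * \<pi> s)
      = (\<Sum>s\<in>C. add_char (- rel_trace emb (s * z)) * \<pi> s)"
  proof (rule sum.reindex_bij_witness[of _ inverse inverse])
    fix s assume s: "s \<in> C"
    have "rel_trace emb (s * z ^ CARD('f)) = rel_trace emb ((inverse s * z) ^ CARD('f))"
      using s by (simp add: power_mult_distrib power_inverse frob_C)
    thus "add_char (- rel_trace emb (inverse s * z)) * \<pi> (inverse s) =
        add_char (- rel_trace emb (s * z ^ CARD('f))) * \<pi> s"
      using s by (simp add: rel_trace_frob pi_inverse)
  qed (auto intro: C_inverse)
  thus ?thesis by (simp add: bessel_def)
qed

text \<open>Conjugation does not change the Bessel function, but it multiplies \<open>z\<close> by \<open>t = z\<^sup>q / z\<close> on the circle.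
  If \<open>\<pi> t = 1\<close>, then \<open>t = w\<^sup>2\<close> with \<open>w\<close> on the circle, so that \<open>w * z\<close> is fixed by conjugation and the norm
  of \<open>z\<close> is the square of this element of the base field.  Hence \<open>\<pi> t = -1\<close> for nonsquare norm.\<close>

lemma bessel_nonsquare:
  assumes z: "z \<in> circle emb d" and d: "d \<in> NQR"
  shows "bessel emb \<pi> z = 0"
proof -
  have d0: "d \<noteq> 0" using d by (auto simp: NQR_def)
  have z0: "z \<noteq> 0" using circle_neq_0[OF z d0] .
  let ?t = "z ^ CARD('f) / z"
  have t: "?t \<in> C" using z0 by (simp add: mem_circle power_divide)
  have "\<pi> ?t \<noteq> 1"
  proof
    assume "\<pi> ?t = 1"
    then obtain w where w: "w \<in> C" "?t = w\<^sup>2" using pi_eq_1_iff[OF t] by auto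
    hence zq: "z ^ CARD('f) = w\<^sup>2 * z" using z0 by (simp add: field_simps)
    have "(w * z) ^ CARD('f) = w * z"
      using w C_neq_0[OF w(1)] by (simp add: power_mult_distrib frob_C zq power2_eq_square)
    then obtain x where "w * z = emb x" by (auto simp: frob_eq_iff_range)
    moreover have "emb d = (w * z)\<^sup>2"
      using z zq by (simp add: mem_circle power2_eq_square mult_ac)
    ultimately have "emb d = emb (x\<^sup>2)" by (simp add: emb_power)
    thus False using d by (auto simp: NQR_def)
  qed
  hence "\<pi> ?t = -1" using pi_cases[OF t] by auto
  hence "bessel emb \<pi> z = - bessel emb \<pi> z"
    using bessel_circle_mult[OF t, of z] bessel_frob[of z] z0 by simp
  thus ?thesis by simp
qed

text \<open>This is the analogue for the circle of the evaluation of Salie sums: summation over the traces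
  leaves two Gauss sums, shifted by \<open>2\<close> and \<open>-2\<close>.\<close>

lemma bessel_emb:
  "bessel emb \<pi> (emb s) = gauss_sum (- s) * (add_char (2 * s) - add_char (- (2 * s))) / of_nat CARD('f)"
proof -
  have shift: "(\<Sum>u\<in>UNIV. add_char (- s * u) * quad_char (u + a)) = add_char (s * a) * gauss_sum (- s)" for a
  proof -
    have "(\<Sum>u\<in>UNIV. add_char (- s * u) * quad_char (u + a))
       = (\<Sum>u\<in>UNIV. add_char (s * a) * (quad_char u * add_char (- s * u)))"
    proof (rule sum.reindex_bij_witness[of _ "\<lambda>u. u - a" "\<lambda>u. u + a"])
      fix u
      have "s * a + - s * (u + a) = - s * u" by (simp add: algebra_simps)
      hence "add_char (s * a) * add_char (- s * (u + a)) = add_char (- s * u)"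
        by (metis char_add)
      thus "add_char (s * a) * (quad_char (u + a) * add_char (- s * (u + a)))
          = add_char (- s * u) * quad_char (u + a)" by (simp add: mult_ac)
    qed auto
    thus ?thesis by (simp add: gauss_sum_def sum_distrib_left)
  qed
  have "(\<Sum>t\<in>C. add_char (- rel_trace emb (t * emb s)) * \<pi> t)
      = (\<Sum>t\<in>C. add_char (- s * rel_trace emb t) * \<pi> t)"
    using rel_trace_emb_mult[of s] by (simp add: mult.commute)
  also have "\<dots> = (\<Sum>u\<in>UNIV. \<Sum>t | t \<in> C \<and> rel_trace emb t = u. add_char (- s * rel_trace emb t) * \<pi> t)"
    by (rule sum.group[symmetric]) (auto simp: finite_C)
  also have "\<dots> = (\<Sum>u\<in>UNIV. add_char (- s * u) * (\<Sum>t | t \<in> C \<and> rel_trace emb t = u. \<pi> t))"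
    by (simp add: sum_distrib_left)
  also have "\<dots> = (\<Sum>u\<in>UNIV. add_char (- s * u) * quad_char (u + 2))
      - (\<Sum>u\<in>UNIV. add_char (- s * u) * quad_char (u + - 2))"
    by (simp add: sum_pi_fibre right_diff_distrib sum_subtractf)
  also have "\<dots> = gauss_sum (- s) * (add_char (2 * s) - add_char (- (2 * s)))"
    unfolding shift by (simp add: algebra_simps)
  finally show ?thesis by (simp add: bessel_def)
qed

text \<open>The Gauss sums at \<open>- s\<close> and \<open>- r * s\<close> differ by the sign \<open>quad_char r\<close>, so only the square of
  their common modulus remains.\<close>

lemma bessel_emb_mult_cnj:
  assumes r: "r \<noteq> 0"
  shows "bessel emb \<pi> (emb s) * cnj (bessel emb \<pi> (emb (r * s))) =
    quad_char r / of_nat CARD('f) *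
      ((add_char (2 * s) - add_char (- (2 * s))) * (add_char (- (2 * r * s)) - add_char (2 * r * s)))"
proof (cases "s = 0")
  case False
  let ?q = "of_nat CARD('f) :: complex"
  let ?d = "add_char (2 * s) - add_char (- (2 * s))"
  let ?e = "add_char (- (2 * r * s)) - add_char (2 * r * s)"
  have q0: "?q \<noteq> 0" by simp
  have e: "cnj (add_char (2 * (r * s)) - add_char (- (2 * (r * s)))) = ?e"
    by (simp add: char_minus mult.assoc)
  have g: "gauss_sum (- (r * s)) = quad_char r * gauss_sum (- s)"
    using gauss_sum_mult[OF card_power two_neq_0 r, of "- s"] by simp
  have "bessel emb \<pi> (emb s) * cnj (bessel emb \<pi> (emb (r * s)))
     = quad_char r * (gauss_sum (- s) * cnj (gauss_sum (- s))) * (?d * ?e) / (?q * ?q)"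
    unfolding bessel_emb complex_cnj_divide complex_cnj_mult e g by simp
  thus ?thesis
    using gauss_sum_times_cnj[OF card_power two_neq_0, of "- s"] False q0 by simp
next
  case True
  thus ?thesis using bessel_emb[of 0] by simp
qed

text \<open>Expanding the product of the two differences gives four sums, which agree in pairs under
  \<open>s \<mapsto> - s\<close>.\<close>

lemma sum_bessel_emb_mult_cnj:
  fixes c r :: 'f
  assumes r: "r \<noteq> 0"
  shows "(\<Sum>s\<in>UNIV. add_char (c * s\<^sup>2) * (bessel emb \<pi> (emb s) * cnj (bessel emb \<pi> (emb (r * s))))) =
    2 * quad_char r / of_nat CARD('f) *
      ((\<Sum>s\<in>UNIV. add_char (c * s\<^sup>2 + 2 * (1 - r) * s)) - (\<Sum>s\<in>UNIV. add_char (c * s\<^sup>2 + 2 * (1 + r) * s)))"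
proof -
  let ?S = "\<lambda>b. \<Sum>s\<in>UNIV. add_char (c * s\<^sup>2 + b * s)"
  have reflect: "?S (- b) = ?S b" for b
    by (rule sum.reindex_bij_witness[of _ uminus uminus]) auto
  have "add_char (c * s\<^sup>2) *
      ((add_char (2 * s) - add_char (- (2 * s))) * (add_char (- (2 * r * s)) - add_char (2 * r * s)))
     = add_char (c * s\<^sup>2 + 2 * (1 - r) * s) - add_char (c * s\<^sup>2 + 2 * (1 + r) * s)
       - add_char (c * s\<^sup>2 + - (2 * (1 + r)) * s) + add_char (c * s\<^sup>2 + - (2 * (1 - r)) * s)" for s
    by (simp add: char_add[symmetric] algebra_simps)
  hence "(\<Sum>s\<in>UNIV. add_char (c * s\<^sup>2) *
      ((add_char (2 * s) - add_char (- (2 * s))) * (add_char (- (2 * r * s)) - add_char (2 * r * s))))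
    = 2 * (?S (2 * (1 - r)) - ?S (2 * (1 + r)))"
    by (simp only: sum.distrib sum_subtractf reflect) simp
  moreover have "(\<Sum>s\<in>UNIV. add_char (c * s\<^sup>2) * (bessel emb \<pi> (emb s) * cnj (bessel emb \<pi> (emb (r * s)))))
    = quad_char r / of_nat CARD('f) * (\<Sum>s\<in>UNIV. add_char (c * s\<^sup>2) *
      ((add_char (2 * s) - add_char (- (2 * s))) * (add_char (- (2 * r * s)) - add_char (2 * r * s))))"
    unfolding bessel_emb_mult_cnj[OF r] sum_distrib_left
    by (intro sum.cong refl mult.left_commute)
  ultimately show ?thesis by simp
qed

end

section \<open>Inner products of the vectors\<close>

lemma H_inner_scale_left: "H_inner (c *s u) w = c * H_inner u w"
  and H_inner_scale_right: "H_inner u (c *s w) = cnj c * H_inner u w"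
  by (simp_all add: H_inner_def sum_distrib_left mult_ac)

lemma cnj_H_inner: "cnj (H_inner u w) = H_inner w u"
  by (simp add: H_inner_def mult.commute)

lemma H_inner_self: "H_inner u u = of_real (cmod (H_inner u u))"
proof -
  have "H_inner u u = of_real (\<Sum>x\<in>nonzero_elems. (cmod (u $ x))\<^sup>2)"
    by (simp add: H_inner_def complex_norm_square del: of_real_power)
  moreover have "(\<Sum>x\<in>nonzero_elems. (cmod (u $ x))\<^sup>2) \<ge> 0" by (simp add: sum_nonneg)
  ultimately show ?thesis by (simp only: norm_of_real abs_of_nonneg)
qed

lemma mem_QR_iff: "x \<in> QR \<longleftrightarrow> quad_char x = 1"
  and mem_NQR_iff: "x \<in> NQR \<longleftrightarrow> quad_char x = -1"
  by (auto simp: QR_def NQR_def quad_char_def)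

lemma mult_sqrt_divide_self:
  assumes "x \<ge> 0"
  shows "a * sqrt x / x = a / sqrt x"
proof -
  have "a * s / (s * s) = a / s" for s :: real by simp
  from this[of "sqrt x"] show ?thesis using assms by simp
qed

locale bessel_lines = quadratic_bessel emb n \<pi>
  for emb :: "'f::{finite,field} \<Rightarrow> 'l::field" and n \<pi> +
  fixes \<theta> :: "'f \<Rightarrow> 'l"
  assumes reps: "representatives emb \<theta>"
begin

abbreviation bvec :: "'f \<Rightarrow> 'f \<Rightarrow> (complex, 'f) vec" where
  "bvec \<equiv> bessel_vector emb \<pi> \<theta>"

abbreviation J :: "'l \<Rightarrow> complex" where
  "J \<equiv> bessel emb \<pi>"

lemma rep_in_circle: "d \<noteq> 0 \<Longrightarrow> \<theta> d \<in> circle emb d"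
  using reps by (simp add: representatives_def)

lemma bvec_nth: "bvec a y $ v = (if v = 0 then 0 else add_char (a * v) * J (\<theta> y * \<theta> v))"
  by (simp add: bessel_vector_def)

lemma bvec_eq_0:
  assumes y: "y \<noteq> 0" and q: "quad_char (y * v) \<noteq> 1"
  shows "bvec a y $ v = 0"
proof (cases "v = 0")
  case False
  hence "y * v \<in> NQR" using y q quad_char_cases[of "y * v"] by (auto simp: mem_NQR_iff)
  moreover have "\<theta> y * \<theta> v \<in> circle emb (y * v)"
    by (intro circle_mult rep_in_circle y False)
  ultimately show ?thesis using bessel_nonsquare by (simp add: bvec_nth)
qed (simp add: bvec_nth)

lemma rep_mult_rep:
  assumes "y \<noteq> 0" "s \<noteq> 0" "y * v = s\<^sup>2"
  obtains t where "t \<in> C" "\<theta> y * \<theta> v = t * emb s"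
proof -
  have "v \<noteq> 0" using assms by auto
  hence "\<theta> y * \<theta> v \<in> circle emb (s\<^sup>2)"
    using circle_mult[of "\<theta> y" y "\<theta> v" v] rep_in_circle assms by simp
  hence "\<theta> y * \<theta> v / emb s \<in> C"
    using circle_divide[OF _ emb_in_circle[of s], of _ "s\<^sup>2"] assms by simp
  thus ?thesis using that[of "\<theta> y * \<theta> v / emb s"] assms by simp
qed

lemma norm_diff_char: "norm (add_char x - add_char y) = norm (add_char (x - y) - 1)" for x y :: 'f
proof -
  have "add_char x - add_char y = add_char y * (add_char (x - y) - 1)"
    by (simp add: right_diff_distrib flip: char_add)
  thus ?thesis using norm_add_char[OF card_power, of y] by (simp add: norm_mult)
qed

lemma norm_bvec_nth:
  assumes "y \<noteq> 0" "s \<noteq> 0" "y * v = s\<^sup>2"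
  shows "norm (bvec a y $ v) = norm (add_char (4 * s) - 1) / sqrt (real CARD('f))"
proof -
  obtain t where t: "t \<in> C" "\<theta> y * \<theta> v = t * emb s" using rep_mult_rep[OF assms] .
  have "v \<noteq> 0" using assms by auto
  hence "norm (bvec a y $ v) = norm (J (emb s))"
    using t by (simp add: bvec_nth norm_mult bessel_circle_mult norm_pi norm_add_char[OF card_power])
  also have "\<dots> = sqrt (real CARD('f)) * norm (add_char (2 * s) - add_char (- (2 * s))) / real CARD('f)"
    using norm_gauss_sum[OF card_power two_neq_0, of "- s"] assms
    by (simp add: bessel_emb norm_mult norm_divide)
  also have "\<dots> = norm (add_char (4 * s) - 1) * sqrt (real CARD('f)) / real CARD('f)"
    unfolding norm_diff_char by simp
  also have "\<dots> = norm (add_char (4 * s) - 1) / sqrt (real CARD('f))"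
    by (rule mult_sqrt_divide_self) simp
  finally show ?thesis .
qed

text \<open>Only the \<open>v\<close> for which \<open>y * v\<close> is a square contribute.  Writing \<open>v = s\<^sup>2 / y\<close> with \<open>s \<noteq> 0\<close> covers each of
  them twice, and moves both arguments of the Bessel function into the base field up to factors from
  the circle, whose characters cancel except for one sign.\<close>

lemma H_inner_bvec:
  assumes y: "y \<noteq> 0" and r: "r \<noteq> 0"
  obtains \<epsilon> where "norm \<epsilon> = 1"
    and "H_inner (bvec a y) (bvec b (y * r\<^sup>2)) =
      \<epsilon> / 2 * (\<Sum>s\<in>UNIV. add_char ((a - b) / y * s\<^sup>2) * (J (emb s) * cnj (J (emb (r * s)))))"
proof -
  let ?y' = "y * r\<^sup>2"
  define F where "F v = bvec a y $ v * cnj (bvec b ?y' $ v)" for v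
  define t' where "t' = \<theta> ?y' / (\<theta> y * emb r)"
  have y': "?y' \<noteq> 0" using y r by simp
  have "\<theta> y * emb r \<in> circle emb ?y'"
    by (intro circle_mult rep_in_circle y emb_in_circle)
  hence "t' \<in> circle emb (?y' / ?y')"
    unfolding t'_def by (rule circle_divide[OF rep_in_circle[OF y']])
  hence t': "t' \<in> C" using y' by simp
  have \<theta>y': "\<theta> ?y' = t' * \<theta> y * emb r"
    using circle_neq_0[OF rep_in_circle[OF y] y] r by (simp add: t'_def)
  have F0: "F v = 0" if "quad_char (y * v) \<noteq> 1" for v
    using bvec_eq_0[OF y that] by (simp add: F_def)
  have "(\<Sum>s\<in>UNIV. F (s\<^sup>2 / y)) = (\<Sum>u\<in>UNIV. (1 + quad_char u) * F (u / y))"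
    by (rule sum_over_squares[OF two_neq_0])
  also have "\<dots> = (\<Sum>u\<in>UNIV. 2 * F (u / y))"
  proof (intro sum.cong refl)
    fix u
    show "(1 + quad_char u) * F (u / y) = 2 * F (u / y)"
      using F0[of "u / y"] y by (cases "quad_char u = 1") auto
  qed
  also have "\<dots> = (\<Sum>v\<in>UNIV. 2 * F v)"
    by (rule sum.reindex_bij_witness[of _ "\<lambda>v. v * y" "\<lambda>u. u / y"]) (use y in auto)
  finally have sum: "(\<Sum>v\<in>UNIV. F v) = (\<Sum>s\<in>UNIV. F (s\<^sup>2 / y)) / 2"
    by (simp flip: sum_distrib_left)
  have summand: "F (s\<^sup>2 / y) =
      \<pi> t' * (add_char ((a - b) / y * s\<^sup>2) * (J (emb s) * cnj (J (emb (r * s)))))" for s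
  proof (cases "s = 0")
    case True
    thus ?thesis using bessel_emb[of 0] by (simp add: F_def bvec_nth)
  next
    case False
    define v where "v = s\<^sup>2 / y"
    have v: "v \<noteq> 0" "y * v = s\<^sup>2" using False y by (auto simp: v_def)
    obtain t where t: "t \<in> C" "\<theta> y * \<theta> v = t * emb s" using rep_mult_rep[OF y False v(2)] .
    have "\<theta> ?y' * \<theta> v = t' * (t * emb (r * s))"
      using t(2) by (simp add: \<theta>y' emb_mult mult_ac)
    hence J': "J (\<theta> ?y' * \<theta> v) = \<pi> t' * (\<pi> t * J (emb (r * s)))"
      using t t' by (simp add: bessel_circle_mult)
    have "add_char (a * v) * cnj (add_char (b * v)) = add_char ((a - b) / y * s\<^sup>2)"
      by (simp add: v_def left_diff_distrib diff_divide_distrib flip: char_add char_minus)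
    hence "F v = add_char ((a - b) / y * s\<^sup>2) * (J (\<theta> y * \<theta> v) * cnj (J (\<theta> ?y' * \<theta> v)))"
      using v by (simp add: F_def bvec_nth mult_ac)
    also have "\<dots> = add_char ((a - b) / y * s\<^sup>2) *
        ((\<pi> t * \<pi> t) * (\<pi> t' * (J (emb s) * cnj (J (emb (r * s))))))"
      using t t' unfolding J' by (simp add: bessel_circle_mult cnj_pi mult_ac)
    finally show ?thesis
      unfolding pi_mult_self[OF t(1)] by (simp add: v_def mult_ac)
  qed
  have "H_inner (bvec a y) (bvec b ?y') = (\<Sum>v\<in>UNIV. F v)"
    unfolding H_inner_def F_def
    by (rule sum.mono_neutral_left) (auto simp: nonzero_elems_def bvec_nth)
  also have "\<dots> = \<pi> t' / 2 * (\<Sum>s\<in>UNIV. add_char ((a - b) / y * s\<^sup>2) * (J (emb s) * cnj (J (emb (r * s)))))"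
    by (simp add: sum summand flip: sum_distrib_left)
  finally show ?thesis using that[of "\<pi> t'"] norm_pi[OF t'] by simp
qed

lemma norm_H_inner_bvec:
  assumes y: "y \<noteq> 0" and r: "r \<noteq> 0"
  shows "norm (H_inner (bvec a y) (bvec b (y * r\<^sup>2))) =
    norm ((\<Sum>s\<in>UNIV. add_char ((a - b) / y * s\<^sup>2 + 2 * (1 - r) * s)) -
          (\<Sum>s\<in>UNIV. add_char ((a - b) / y * s\<^sup>2 + 2 * (1 + r) * s))) / real CARD('f)"
proof -
  have "norm (quad_char r) = 1" using quad_char_cases[OF r] by auto
  moreover obtain \<epsilon> where "norm \<epsilon> = 1" "H_inner (bvec a y) (bvec b (y * r\<^sup>2)) =
      \<epsilon> / 2 * (\<Sum>s\<in>UNIV. add_char ((a - b) / y * s\<^sup>2) * (J (emb s) * cnj (J (emb (r * s)))))"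
    using H_inner_bvec[OF y r] .
  ultimately show ?thesis
    unfolding sum_bessel_emb_mult_cnj[OF r] by (simp add: norm_mult norm_divide)
qed

text \<open>Both sums are linear here, so they vanish unless \<open>r = 1\<close> or \<open>r = -1\<close>; in these cases the two
  vectors are equal.\<close>

lemma norm_H_inner_bvec_same_char:
  assumes y: "y \<noteq> 0" and r: "r \<noteq> 0"
  shows "norm (H_inner (bvec a y) (bvec a (y * r\<^sup>2))) = (if r = 1 \<or> r = -1 then 1 else 0)"
proof -
  have lin: "(\<Sum>s\<in>UNIV. add_char (2 * c * s)) = (if c = (0::'f) then of_nat CARD('f) else 0)" for c
    using sum_add_char[OF card_power, of "2 * c"] two_neq_0 by simp
  have "1 + r = 0 \<longleftrightarrow> r = -1" by (rule add_eq_0_iff)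
  moreover have "1 - r = 0 \<longleftrightarrow> r = 1" by auto
  moreover have "(1::'f) \<noteq> -1" using two_neq_0 by (metis add.right_inverse one_add_one)
  ultimately show ?thesis
    by (simp only: norm_H_inner_bvec[OF y r] diff_self div_0 mult_zero_left add_0_left lin) auto
qed

text \<open>Completing the square turns both sums into the same Gauss sum times values of the
  additive character.\<close>

lemma norm_H_inner_bvec_distinct_char:
  assumes y: "y \<noteq> 0" and r: "r \<noteq> 0" and ab: "a \<noteq> b"
  shows "norm (H_inner (bvec a y) (bvec b (y * r\<^sup>2))) =
    norm (add_char (4 * r * y / (a - b)) - 1) / sqrt (real CARD('f))"
proof -
  let ?q = "real CARD('f)"
  define c where "c = (a - b) / y"
  have c: "c \<noteq> 0" using ab y by (simp add: c_def)
  have exp: "- (2 * z)\<^sup>2 / (4 * c) = - (z\<^sup>2 / c)" for z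
    using four_neq_0[OF card_power two_neq_0] by (simp add: power_mult_distrib)
  have cr: "- ((1 - r)\<^sup>2 / c) - - ((1 + r)\<^sup>2 / c) = 4 * r * y / (a - b)"
  proof -
    have "(1 + r)\<^sup>2 - (1 - r)\<^sup>2 = 4 * r" by (simp add: power2_eq_square algebra_simps)
    hence "- ((1 - r)\<^sup>2 / c) - - ((1 + r)\<^sup>2 / c) = 4 * r / c"
      by (simp flip: diff_divide_distrib)
    thus ?thesis by (simp add: c_def)
  qed
  have "norm (H_inner (bvec a y) (bvec b (y * r\<^sup>2))) =
      norm ((add_char (- ((1 - r)\<^sup>2 / c)) - add_char (- ((1 + r)\<^sup>2 / c))) * gauss_sum c) / ?q"
    unfolding norm_H_inner_bvec[OF y r] c_def[symmetric]
      sum_add_char_quadratic[OF card_power two_neq_0 c] exp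
    by (simp add: left_diff_distrib)
  also have "\<dots> = norm (add_char (4 * r * y / (a - b)) - 1) * sqrt ?q / ?q"
    by (simp only: norm_mult norm_diff_char cr norm_gauss_sum[OF card_power two_neq_0 c])
  also have "\<dots> = norm (add_char (4 * r * y / (a - b)) - 1) / sqrt ?q"
    by (rule mult_sqrt_divide_self) simp
  finally show ?thesis .
qed

lemma H_inner_bvec_self:
  assumes y: "y \<noteq> 0"
  shows "H_inner (bvec a y) (bvec a y) = 1"
  using norm_H_inner_bvec_same_char[OF y, of 1 a] H_inner_self[of "bvec a y"] by simp

text \<open>Orthogonality is covered by \<open>x = 0\<close>; this makes the form of the modulus the same for all pairs of
  vectors.\<close>

lemma norm_H_inner_bvec_bvec:
  assumes y: "y \<noteq> 0" and y': "y' \<noteq> 0" and ne: "(a, y) \<noteq> (b, y')"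
  shows "\<exists>x::'f. norm (H_inner (bvec a y) (bvec b y')) = norm (add_char x - 1) / sqrt (real CARD('f))"
proof (cases "\<exists>r. y' = y * r\<^sup>2")
  case True
  then obtain r where r: "y' = y * r\<^sup>2" by auto
  hence r0: "r \<noteq> 0" using y' by auto
  show ?thesis
  proof (cases "a = b")
    case True
    hence "r \<noteq> 1" "r \<noteq> -1" using ne r by auto
    hence "norm (H_inner (bvec a y) (bvec b y')) = 0"
      using norm_H_inner_bvec_same_char[OF y r0, of a] True r by simp
    thus ?thesis by (intro exI[of _ 0]) (simp add: char_0)
  qed (use norm_H_inner_bvec_distinct_char[OF y r0] r in blast)
next
  case False
  have "bvec a y $ v * cnj (bvec b y' $ v) = 0" if v: "v \<in> nonzero_elems" for v
  proof (rule ccontr)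
    assume nz: "bvec a y $ v * cnj (bvec b y' $ v) \<noteq> 0"
    hence "quad_char (y * v) = 1" "quad_char (y' * v) = 1"
      using bvec_eq_0[OF y, of v] bvec_eq_0[OF y', of v] by auto
    then obtain s s' where s: "y * v = s\<^sup>2" "y' * v = s'\<^sup>2"
      by (auto simp: QR_def simp flip: mem_QR_iff)
    have v0: "v \<noteq> 0" using v by (simp add: nonzero_elems_def)
    hence "s \<noteq> 0" using s y by auto
    have "y' * (y * v) = y * (y' * v)" by (simp only: mult_ac)
    hence "y' * s\<^sup>2 = y * s'\<^sup>2" by (simp only: s)
    hence "y' = y * (s' / s)\<^sup>2" using \<open>s \<noteq> 0\<close> by (simp add: power_divide field_simps)
    thus False using False by blast
  qed
  hence "H_inner (bvec a y) (bvec b y') = 0"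
    unfolding H_inner_def by (intro sum.neutral) blast
  thus ?thesis by (intro exI[of _ 0]) (simp add: char_0)
qed

lemma H_inner_delta_right:
  assumes "y \<noteq> 0"
  shows "H_inner u (delta_vector y) = u $ y"
proof -
  have "H_inner u (delta_vector y) = (\<Sum>x\<in>nonzero_elems. if x = y then u $ x else 0)"
    unfolding H_inner_def by (intro sum.cong) (auto simp: delta_vector_def)
  thus ?thesis using assms by (simp add: nonzero_elems_def)
qed

lemma delta_vector_nth: "delta_vector y $ v = (if v = y then 1 else 0)"
  by (simp add: delta_vector_def)

lemma norm_H_inner_bvec_delta:
  assumes y: "y \<noteq> 0" and v: "v \<noteq> 0"
  shows "\<exists>x::'f. norm (H_inner (bvec a y) (delta_vector v)) = norm (add_char x - 1) / sqrt (real CARD('f))"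
proof (cases "quad_char (y * v) = 1")
  case True
  then obtain s where s: "y * v = s\<^sup>2" by (auto simp: QR_def simp flip: mem_QR_iff)
  hence "s \<noteq> 0" using y v by auto
  from norm_bvec_nth[OF y this s, of a] show ?thesis by (auto simp: H_inner_delta_right[OF v])
next
  case False
  thus ?thesis
    by (intro exI[of _ 0]) (simp add: char_0 H_inner_delta_right[OF v] bvec_eq_0[OF y])
qed

section \<open>The line system\<close>

text \<open>One index set for both kinds of vectors: \<open>None\<close> stands for the standard basis vectors.\<close>

definition phi_vector :: "'f option \<times> 'f \<Rightarrow> (complex, 'f) vec" where
  "phi_vector i = (case i of (None, y) \<Rightarrow> delta_vector y | (Some a, y) \<Rightarrow> bvec a y)"

definition line :: "'f option \<times> 'f \<Rightarrow> (complex, 'f) vec set" where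
  "line i = vec.span {phi_vector i}"

abbreviation idx :: "('f option \<times> 'f) set" where
  "idx \<equiv> UNIV \<times> nonzero_elems"

lemma line_system_eq: "line_system emb \<pi> \<theta> = line ` idx"
proof -
  have "Phi emb \<pi> \<theta> = phi_vector ` idx"
  proof (intro equalityI subsetI)
    fix u assume "u \<in> Phi emb \<pi> \<theta>"
    then consider a y where "y \<noteq> 0" "u = phi_vector (Some a, y)" | y where "y \<noteq> 0" "u = phi_vector (None, y)"
      by (auto simp: Phi_def phi_vector_def)
    thus "u \<in> phi_vector ` idx" by cases (auto simp: nonzero_elems_def)
  qed (auto simp: Phi_def phi_vector_def nonzero_elems_def split: option.splits)
  thus ?thesis by (auto simp: line_system_def line_def)
qed

lemma H_inner_phi_self: "i \<in> idx \<Longrightarrow> H_inner (phi_vector i) (phi_vector i) = 1"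
  by (auto simp: phi_vector_def nonzero_elems_def H_inner_bvec_self H_inner_delta_right
      delta_vector_nth split: option.splits)

lemma norm_H_inner_phi:
  assumes "i \<in> idx" "j \<in> idx" "i \<noteq> j"
  shows "\<exists>x::'f. norm (H_inner (phi_vector i) (phi_vector j)) = norm (add_char x - 1) / sqrt (real CARD('f))"
proof -
  obtain \<alpha> y \<beta> z where ij: "i = (\<alpha>, y)" "j = (\<beta>, z)" by (metis surj_pair)
  have y: "y \<noteq> 0" and z: "z \<noteq> 0" using assms ij by (auto simp: nonzero_elems_def)
  have sym: "norm (H_inner u w) = norm (H_inner w u)" for u w :: "(complex, 'f) vec"
    by (metis cnj_H_inner complex_mod_cnj)
  show ?thesis
  proof (cases \<alpha>; cases \<beta>)
    assume "\<alpha> = None" "\<beta> = None"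
    thus ?thesis using ij assms(3) z
      by (intro exI[of _ 0]) (simp add: char_0 phi_vector_def H_inner_delta_right delta_vector_nth)
  next
    fix b assume "\<alpha> = None" "\<beta> = Some b"
    thus ?thesis using norm_H_inner_bvec_delta[OF z y, of b] ij
      by (simp add: phi_vector_def sym[of "delta_vector y"])
  next
    fix a assume "\<alpha> = Some a" "\<beta> = None"
    thus ?thesis using norm_H_inner_bvec_delta[OF y z, of a] ij by (simp add: phi_vector_def)
  next
    fix a b assume "\<alpha> = Some a" "\<beta> = Some b"
    thus ?thesis using norm_H_inner_bvec_bvec[OF y z, of a b] ij assms(3) by (simp add: phi_vector_def)
  qed
qed

lemma unit_vector_in_line:
  assumes "i \<in> idx" "u \<in> line i" "H_inner u u = 1"
  obtains \<alpha> where "norm \<alpha> = 1" "u = \<alpha> *s phi_vector i"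
proof -
  obtain \<alpha> where u: "u = \<alpha> *s phi_vector i"
    using assms(2) by (auto simp: line_def vec.span_singleton)
  have "cnj \<alpha> * \<alpha> = 1"
    using assms(3) H_inner_phi_self[OF assms(1)] by (simp add: u H_inner_scale_left H_inner_scale_right)
  hence "(norm \<alpha>)\<^sup>2 = 1" by (metis complex_norm_square mult.commute of_real_eq_1_iff)
  hence "norm \<alpha> = 1" using norm_ge_zero[of \<alpha>] unfolding power2_eq_1_iff by linarith
  thus ?thesis using u that by blast
qed

lemma norm_H_inner_lines:
  assumes "i \<in> idx" "u \<in> line i" "H_inner u u = 1" "j \<in> idx" "w \<in> line j" "H_inner w w = 1"
  shows "norm (H_inner u w) = norm (H_inner (phi_vector i) (phi_vector j))"
proof -
  obtain \<alpha> where \<alpha>: "norm \<alpha> = 1" "u = \<alpha> *s phi_vector i"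
    using unit_vector_in_line assms(1-3) by blast
  obtain \<beta> where \<beta>: "norm \<beta> = 1" "w = \<beta> *s phi_vector j"
    using unit_vector_in_line assms(4-6) by blast
  show ?thesis using \<alpha>(1) \<beta>(1)
    by (simp add: \<alpha>(2) \<beta>(2) H_inner_scale_left H_inner_scale_right norm_mult)
qed

lemma phi_in_line: "phi_vector i \<in> line i"
  by (simp add: line_def vec.span_base)

lemma subspace_H_space: "vec.subspace (H_space A)"
  by (simp add: vec.subspace_def H_space_def)

lemma line_subset_iff: "line i \<subseteq> H_space A \<longleftrightarrow> phi_vector i \<in> H_space A"
  using phi_in_line[of i] vec.span_minimal[OF _ subspace_H_space, of "{phi_vector i}" A]
  unfolding line_def by blast

text \<open>Each vector is supported on the square class of its index \<open>snd i\<close>.\<close>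

lemma line_subset_QR:
  assumes "i \<in> idx"
  shows "line i \<subseteq> H_space QR \<longleftrightarrow> snd i \<in> QR" "line i \<subseteq> H_space NQR \<longleftrightarrow> snd i \<in> NQR"
proof -
  obtain \<alpha> y where i: "i = (\<alpha>, y)" and y: "y \<noteq> 0"
    using assms by (cases i) (auto simp: nonzero_elems_def)
  have supp: "quad_char v = quad_char y" if v: "phi_vector i $ v \<noteq> 0" for v
  proof (cases \<alpha>)
    case None
    thus ?thesis using v i by (auto simp: phi_vector_def delta_vector_def split: if_splits)
  next
    case (Some a)
    hence "quad_char (y * v) = 1" using v i bvec_eq_0[OF y] by (auto simp: phi_vector_def)
    hence "quad_char y * quad_char v = 1" by (simp add: quad_char_mult[OF two_neq_0])
    hence "quad_char y * (quad_char y * quad_char v) = quad_char y" by simp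
    thus ?thesis using quad_char_squared[OF y] by (simp flip: mult.assoc)
  qed
  have "phi_vector i \<noteq> 0"
    using H_inner_phi_self[OF assms] by (auto simp: H_inner_def)
  then obtain v where v: "phi_vector i $ v \<noteq> 0" by (auto simp: vec_eq_iff)
  have supported: "phi_vector i \<in> H_space {x. quad_char x = c} \<longleftrightarrow> quad_char y = c" for c
  proof
    assume "phi_vector i \<in> H_space {x. quad_char x = c}"
    hence "quad_char v = c" using v by (auto simp: H_space_def)
    thus "quad_char y = c" by (simp only: supp[OF v])
  next
    assume "quad_char y = c"
    thus "phi_vector i \<in> H_space {x. quad_char x = c}"
      unfolding H_space_def using supp by blast
  qed
  have classes: "QR = {x::'f. quad_char x = 1}" "NQR = {x::'f. quad_char x = -1}"
    by (auto simp: mem_QR_iff mem_NQR_iff)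
  show "line i \<subseteq> H_space QR \<longleftrightarrow> snd i \<in> QR" "line i \<subseteq> H_space NQR \<longleftrightarrow> snd i \<in> NQR"
    unfolding line_subset_iff classes supported by (simp_all add: i)
qed

lemma dim_line:
  assumes "i \<in> idx"
  shows "vec.dim (line i) = 1"
proof -
  have "phi_vector i \<noteq> 0"
    using H_inner_phi_self[OF assms] by (auto simp: H_inner_def)
  thus ?thesis by (simp add: line_def vec.dim_span)
qed

lemma card_idx: "card (UNIV \<times> A :: ('f option \<times> 'f) set) = (CARD('f) + 1) * card A"
  by (simp add: card_cartesian_product card_UNIV_option)

context
  assumes char3: "CHAR('f) = 3" and large: "CARD('f) > 3"
begin

text \<open>A primitive cube root of unity \<open>w\<close> satisfies \<open>w\<^sup>2 + w + 1 = 0\<close>, hence \<open>w + cnj w = -1\<close> and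
  \<open>\<bar>w - 1\<bar>\<^sup>2 = 2 - (w + cnj w) = 3\<close>.\<close>

lemma norm_char_minus_1: "norm (add_char (x::'f) - 1) = (if add_char x = 1 then 0 else sqrt 3)"
proof (cases "add_char x = 1")
  case False
  let ?w = "add_char x"
  have "(?w - 1) * (?w\<^sup>2 + ?w + 1) = ?w ^ 3 - 1" by (simp add: algebra_simps power2_eq_square power3_eq_cube)
  also have "\<dots> = 0" using add_char_power_CHAR[OF card_power, of x] by (simp add: char3)
  finally have "?w\<^sup>2 + ?w + 1 = 0" using False by simp
  moreover have unit: "?w * cnj ?w = 1"
    using norm_add_char[OF card_power, of x] complex_norm_square[of ?w] by simp
  ultimately have "?w + cnj ?w = -1"
  proof -
    have "cnj ?w * (?w\<^sup>2 + ?w + 1) = ?w * (?w * cnj ?w) + ?w * cnj ?w + cnj ?w"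
      by (simp add: algebra_simps power2_eq_square)
    hence "?w + 1 + cnj ?w = 0"
      using \<open>?w\<^sup>2 + ?w + 1 = 0\<close> by (simp only: unit mult_1_right mult_zero_right)
    thus ?thesis by (simp add: eq_neg_iff_add_eq_0 add_ac)
  qed
  have "complex_of_real ((norm (?w - 1))\<^sup>2) = ?w * cnj ?w - (?w + cnj ?w) + 1"
    by (simp only: complex_norm_square) (simp add: algebra_simps)
  also have "\<dots> = complex_of_real 3" by (simp add: unit \<open>?w + cnj ?w = -1\<close>)
  finally have "(norm (?w - 1))\<^sup>2 = 3" by (simp only: of_real_eq_iff)
  thus ?thesis using False by (simp add: real_sqrt_unique)
qed simp

lemma norm_H_inner_phi_cases:
  assumes "i \<in> idx" "j \<in> idx" "i \<noteq> j"
  shows "norm (H_inner (phi_vector i) (phi_vector j)) \<in> {0, sqrt (3 / real CARD('f))}"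
proof -
  obtain x :: 'f where x:
    "norm (H_inner (phi_vector i) (phi_vector j)) = norm (add_char x - 1) / sqrt (real CARD('f))"
    using norm_H_inner_phi[OF assms] by blast
  show ?thesis unfolding x norm_char_minus_1 by (simp add: real_sqrt_divide)
qed

text \<open>Since \<open>sqrt (3 / q) < 1\<close>, distinct indices give distinct lines.\<close>

lemma inj_on_line: "inj_on line idx"
proof (rule inj_onI, rule ccontr)
  fix i j assume i: "i \<in> idx" and j: "j \<in> idx" and eq: "line i = line j" and ne: "i \<noteq> j"
  have "norm (H_inner (phi_vector i) (phi_vector i)) = norm (H_inner (phi_vector i) (phi_vector j))"
    using norm_H_inner_lines[OF i phi_in_line _ j, of "phi_vector i"] phi_in_line[of i] eq
      H_inner_phi_self[OF i] by simp
  hence "norm (H_inner (phi_vector i) (phi_vector j)) = 1" by (simp add: H_inner_phi_self[OF i])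
  moreover have "sqrt (3 / real CARD('f)) < 1" using large by simp
  ultimately show False using norm_H_inner_phi_cases[OF i j ne] by auto
qed

text \<open>Two standard basis vectors attain \<open>0\<close>.  The other value is attained by the Bessel vector of index
  \<open>1\<close> and the basis vector at \<open>s\<^sup>2\<close>, where \<open>4 * s\<close> is chosen outside the kernel of the additive
  character.\<close>

lemma angle_set_lines: "angle_set (line ` idx) = {0, sqrt (3 / real CARD('f))}"
proof (intro equalityI subsetI)
  fix x assume "x \<in> angle_set (line ` idx)"
  then obtain u w U W where *: "x = cmod (H_inner u w)" "U \<in> line ` idx" "W \<in> line ` idx" "U \<noteq> W"
    "u \<in> U" "w \<in> W" "H_inner u u = 1" "H_inner w w = 1"
    unfolding angle_set_def by blast
  then obtain i j where "i \<in> idx" "j \<in> idx" "U = line i" "W = line j" by blast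
  with * show "x \<in> {0, sqrt (3 / real CARD('f))}"
    using norm_H_inner_phi_cases[of i j] norm_H_inner_lines[of i u j w] by auto
next
  have angle: "cmod (H_inner (phi_vector i) (phi_vector j)) \<in> angle_set (line ` idx)"
    if ij: "i \<in> idx" "j \<in> idx" "i \<noteq> j" for i j
  proof -
    have "line i \<noteq> line j" using inj_onD[OF inj_on_line] ij by blast
    moreover have "line i \<in> line ` idx" "line j \<in> line ` idx" using ij by blast+
    ultimately show ?thesis
      using phi_in_line[of i] phi_in_line[of j] H_inner_phi_self[OF ij(1)] H_inner_phi_self[OF ij(2)]
      unfolding angle_set_def by blast
  qed
  have "(1::'f) \<noteq> -1" using two_neq_0 by (metis add.right_inverse one_add_one)
  hence zero: "0 \<in> angle_set (line ` idx)"
    using angle[of "(None, 1)" "(None, -1)"]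
    by (simp add: phi_vector_def nonzero_elems_def H_inner_delta_right delta_vector_nth)
  obtain x :: 'f where x: "add_char x \<noteq> 1" using add_char_nontrivial[OF card_power] by blast
  define s where "s = x / 4"
  have s: "4 * s = x" using four_neq_0[OF card_power two_neq_0] by (simp add: s_def)
  have s0: "s \<noteq> 0" using x s by (auto simp: char_0)
  have "norm (bvec 0 1 $ s\<^sup>2) = sqrt (3 / real CARD('f))"
    using norm_bvec_nth[of 1 s "s\<^sup>2" 0] s0 x by (simp add: s norm_char_minus_1 real_sqrt_divide)
  hence "sqrt (3 / real CARD('f)) \<in> angle_set (line ` idx)"
    using angle[of "(Some 0, 1)" "(None, s\<^sup>2)"] s0
    by (simp add: phi_vector_def nonzero_elems_def H_inner_delta_right)
  thus "y \<in> angle_set (line ` idx)" if "y \<in> {0, sqrt (3 / real CARD('f))}" for y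
    using zero that by auto
qed

end

end

theorem theorem2:
  fixes emb :: "'f::{finite,field} \<Rightarrow> 'l::field"
    and \<pi>\<^sub>2 :: "'l \<Rightarrow> complex"
    and \<theta> :: "'f \<Rightarrow> 'l"
    and q k :: nat
  defines "q \<equiv> CARD('f)"
    and "LL \<equiv> line_system emb \<pi>\<^sub>2 \<theta>"
    and "LLplus \<equiv> {U \<in> line_system emb \<pi>\<^sub>2 \<theta>. U \<subseteq> H_space QR}"
    and "LLminus \<equiv> {U \<in> line_system emb \<pi>\<^sub>2 \<theta>. U \<subseteq> H_space NQR}"
  assumes "q = 3 ^ k" and "k \<ge> 2"
    and "quadratic_extension emb"
    and "order_two_character (circle emb 1) \<pi>\<^sub>2"
    and "representatives emb \<theta>"
  shows "vec.dim (H_space (nonzero_elems :: 'f set)) = q - 1 \<and>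
         (\<forall>U\<in>LL. vec.subspace U \<and> vec.dim U = 1 \<and> U \<subseteq> H_space nonzero_elems) \<and>
         card LL = q\<^sup>2 - 1 \<and>
         angle_set LL = {0, sqrt (3 / real q)} \<and>
         LL = LLplus \<union> LLminus \<and> LLplus \<inter> LLminus = {} \<and>
         2 * card LLplus = card LL \<and> 2 * card LLminus = card LL"
proof -
  have card: "CARD('f) = 3 ^ k" using assms(5) by (simp add: q_def)
  have char3: "CHAR('f) = 3" by (rule CHAR_eq_prime_base[OF card]) simp
  have two: "(2::'f) \<noteq> 0"
    using of_nat_eq_0_iff_char_dvd[of 2, where 'a='f] by (simp add: char3)
  interpret bessel_lines emb k \<pi>\<^sub>2 \<theta>
    using card char3 two assms(7-9) by unfold_locales simp_all
  have "(3::nat) ^ 1 < 3 ^ k" using \<open>k \<ge> 2\<close> by (intro power_strict_increasing) auto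
  hence large: "CARD('f) > 3" by (simp add: card)
  have LL: "LL = line ` idx" by (simp add: LL_def line_system_eq)
  have split: "(nonzero_elems :: 'f set) = QR \<union> NQR" "QR \<inter> NQR = ({} :: 'f set)"
    by (auto simp: nonzero_elems_def QR_def NQR_def)
  have plus: "LLplus = line ` (UNIV \<times> QR)" and minus: "LLminus = line ` (UNIV \<times> NQR)"
    using line_subset_QR split unfolding LLplus_def LLminus_def line_system_eq by fastforce+
  have inj: "inj_on line idx" by (rule inj_on_line[OF char3 large])
  have card_line: "card (line ` (UNIV \<times> A)) = (q + 1) * card A" if "A \<subseteq> nonzero_elems" for A
    using card_image[OF inj_on_subset[OF inj, of "UNIV \<times> A"]] that
    by (auto simp: card_idx q_def)
  have "nonzero_elems = UNIV - {0::'f}" by (auto simp: nonzero_elems_def)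
  moreover have "card (UNIV - {0::'f}) = q - 1" by (simp add: q_def card_Diff_subset)
  ultimately have nz: "card (nonzero_elems :: 'f set) = q - 1" by (simp only:)
  have dim: "vec.dim (H_space (nonzero_elems :: 'f set)) = q - 1"
    using dim_substandard_cart[of "nonzero_elems :: 'f set"] nz by (simp add: H_space_def)
  have cardLL: "card LL = (q + 1) * (q - 1)" unfolding LL using card_line[of nonzero_elems] nz by simp
  also have "\<dots> = q\<^sup>2 - 1" by (simp add: power2_eq_square algebra_simps)
  finally have cardq: "card LL = q\<^sup>2 - 1" .
  have lines: "\<forall>U\<in>LL. vec.subspace U \<and> vec.dim U = 1 \<and> U \<subseteq> H_space nonzero_elems"
  proof
    fix U assume "U \<in> LL"
    then obtain i where i: "i \<in> idx" "U = line i" by (auto simp: LL)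
    have "H_space QR \<subseteq> (H_space nonzero_elems :: (complex, 'f) vec set)"
      "H_space NQR \<subseteq> (H_space nonzero_elems :: (complex, 'f) vec set)"
      using split by (auto simp: H_space_def)
    moreover have "snd i \<in> QR \<or> snd i \<in> NQR" using i split by auto
    ultimately have "U \<subseteq> H_space nonzero_elems"
      using line_subset_QR[OF i(1)] i by blast
    thus "vec.subspace U \<and> vec.dim U = 1 \<and> U \<subseteq> H_space nonzero_elems"
      using i dim_line by (auto simp: line_def)
  qed
  have union: "LL = LLplus \<union> LLminus" unfolding LL plus minus split(1) by blast
  have disj: "LLplus \<inter> LLminus = {}"
  proof -
    have "line ` (UNIV \<times> QR) \<inter> line ` (UNIV \<times> NQR) = line ` ((UNIV \<times> QR) \<inter> (UNIV \<times> NQR))"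
      by (rule inj_on_image_Int[OF inj, symmetric]) (auto simp: split)
    thus ?thesis using split(2) by (auto simp: plus minus)
  qed
  have half: "2 * card LLplus = card LL" "2 * card LLminus = card LL"
    using card_line[of QR] card_line[of NQR] card_QR[OF two] split(1)
    unfolding plus minus cardLL q_def by (metis Un_upper1 Un_upper2 mult.left_commute)+
  have angles: "angle_set LL = {0, sqrt (3 / real q)}"
    unfolding LL q_def by (rule angle_set_lines[OF char3 large])
  show ?thesis
    using dim lines cardq angles union disj half by (intro conjI)
qed

end
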